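(* Let $d=1$, $\mu>-\frac12$ and $n\ge0$. For $0\le k\le n$ define $$\mathsf{V}_{k,n}(x,t)=\sum_{j=0}^{\lfloor k/2\rfloor}c_{k,j}^{\mu}\,\mathsf{S}_{k-2j,n}(x,t).$$ Then $\mathsf{V}_{k,n}(x,t)=t^{n-k}x^k+\cdots$ is a monomial polynomial of degree $n$, that is, $\mathsf{V}_{k,n}(x,t)-t^{n-k}x^k$ is a polynomial of total degree at most $n-1$ in $(x,t)$, and $\{\mathsf{V}_{k,n}:0\le k\le n\}$ is the monomial basis of $\mathcal{V}_n(\mathbb{V}^2,W_\mu)$ (in particular it is a basis of this space).
   Context: $\mathbb{V}^2=\{(x,t)\in\mathbb{R}^2:|x|\le t,\ t\ge0\}$ and $W_\mu(x,t)=w(t)(t^2-x^2)^{\mu-\frac12}$, where $w$ is a weight function on $\mathbb{R}_+=[0,\infty)$ (possibly supported on $[0,1]$): $w\ge0$ and $\int_0^\infty t^{2\mu+j}w(t)\,dt$ is finite and positive for all integers $j\ge0$. $\mathcal{V}_n(\mathbb{V}^2,W_\mu)$ is the space of polynomials of degree at most $n$ in $(x,t)$ that are orthogonal to all polynomials of degree at most $n-1$ with respect to $\langle f,g\rangle=\int_{\mathbb{V}^2}fg\,W_\mu\,dx\,dt$. The monomial basis of this space is its basis whose elements have the form $t^{n-k}x^k+(\text{polynomial of degree}\le n-1)$, $0\le k\le n$. For $0\le k\le n$, $q_{n-k}^{2k+2\mu}(t)=t^{n-k}+\cdots$ is the monic polynomial of degree $n-k$ orthogonal with respect to $t^{2k+2\mu}w(t)$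 on $\mathbb{R}_+$, and $$\mathsf{S}_{k,n}(x,t)=q_{n-k}^{2k+2\mu}(t)\,t^kC_k^{\mu}\!\left(\tfrac{x}{t}\right),$$ where $C_k^\mu$ is the Gegenbauer polynomial if $\mu\ne0$, and where for $\mu=0$ the polynomial $C_k^\mu$ is replaced by the Chebyshev polynomial $T_k$. With $(a)_k=a(a+1)\cdots(a+k-1)$, the coefficients are, for $\mu\neq0$, $$c_{k,j}^\mu=\frac{k!}{2^k}\,\frac{k-2j+\mu}{(\mu)_{k-j+1}\,j!},$$ and, for $\mu=0$, $c_{k,j}^0=\frac{1}{2^k}\binom{k}{j}\cdot 2$ if $k\ne2j$ and $c_{k,j}^0=\frac1{2^k}\binom{k}{j}$ if $k=2j$. *)

theory Defs
  imports "HOL-Analysis.Analysis"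
begin

section \<open>Polynomials in two variables\<close>

text \<open>
  A polynomial in \<open>(x, t)\<close> is an element of \<open>\<real>[t][x]\<close>: the outer variable is \<open>x\<close>, the inner
  one is \<open>t\<close>, so that \<open>coeff (coeff P i) j\<close> is the coefficient of \<open>x\<^sup>i t\<^sup>j\<close>.
\<close>

type_synonym bpoly = "real poly poly"

definition bpoly_eval :: "bpoly \<Rightarrow> real \<Rightarrow> real \<Rightarrow> real" where
  "bpoly_eval P x t = poly (poly P [:x:]) t"

definition bpoly_scale :: "real \<Rightarrow> bpoly \<Rightarrow> bpoly" where
  "bpoly_scale c P = smult [:c:] P"

interpretation bpoly: vector_space bpoly_scale
proof unfold_locales
  fix a b :: real and P :: bpoly
  have "[:a + b:] = [:a:] + [:b:]" by simp
  then show "bpoly_scale (a + b) P = bpoly_scale a P + bpoly_scale b P"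
    by (simp only: bpoly_scale_def smult_add_left)
qed (simp_all add: bpoly_scale_def smult_add_right mult.commute flip: one_pCons)

text \<open>A strict bound is used so that the case \<open>m = 0\<close> (``degree at most \<open>-1\<close>'') is the zero
  polynomial only.\<close>

definition bpolys_deg_less :: "nat \<Rightarrow> bpoly set" where
  "bpolys_deg_less m = {P. \<forall>i j. coeff (coeff P i) j \<noteq> 0 \<longrightarrow> i + j < m}"

definition bpolys_deg_le :: "nat \<Rightarrow> bpoly set" where
  "bpolys_deg_le m = {P. \<forall>i j. coeff (coeff P i) j \<noteq> 0 \<longrightarrow> i + j \<le> m}"

definition bmonom :: "nat \<Rightarrow> nat \<Rightarrow> bpoly" where
  "bmonom i j = monom (monom 1 j) i"

lemma bpoly_eval_bmonom: "bpoly_eval (bmonom i j) x t = x ^ i * t ^ j"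
  by (simp add: bpoly_eval_def bmonom_def poly_monom poly_const_pow)

text \<open>The polynomial \<open>t\<^sup>k p(x/t)\<close>, for \<open>p\<close> of degree at most \<open>k\<close>.\<close>

definition homogenize :: "nat \<Rightarrow> real poly \<Rightarrow> bpoly" where
  "homogenize k p = (\<Sum>i\<le>k. bpoly_scale (coeff p i) (bmonom i (k - i)))"

lemma bpoly_eval_homogenize:
  assumes "degree p \<le> k" "t \<noteq> 0"
  shows "bpoly_eval (homogenize k p) x t = t ^ k * poly p (x / t)"
proof -
  have "bpoly_eval (homogenize k p) x t = (\<Sum>i\<le>k. coeff p i * (x ^ i * t ^ (k - i)))"
    unfolding bpoly_eval_bmonom[symmetric]
    by (simp add: bpoly_eval_def homogenize_def bpoly_scale_def poly_sum)
  also have "\<dots> = (\<Sum>i\<le>k. t ^ k * (coeff p i * (x / t) ^ i))"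
    using assms(2) by (intro sum.cong) (auto simp: power_diff power_divide)
  also have "\<dots> = t ^ k * poly p (x / t)"
  proof -
    have "poly p (x / t) = (\<Sum>i\<le>k. coeff p i * (x / t) ^ i)"
      unfolding poly_altdef using assms(1)
      by (intro sum.mono_neutral_left) (auto simp: coeff_eq_0)
    then show ?thesis by (simp add: sum_distrib_left)
  qed
  finally show ?thesis .
qed

section \<open>The weight and the spaces of orthogonal polynomials on the cone\<close>

definition cone :: "(real \<times> real) set" where
  "cone = {(x, t). \<bar>x\<bar> \<le> t \<and> 0 \<le> t}"

definition weight_on_halfline :: "real \<Rightarrow> (real \<Rightarrow> real) \<Rightarrow> bool" where
  "weight_on_halfline \<mu> w \<longleftrightarrow>
     (\<forall>t\<ge>0. 0 \<le> w t) \<and>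
     (\<forall>j::nat. set_integrable lebesgue {0..} (\<lambda>t. t powr (2 * \<mu> + real j) * w t) \<and>
               0 < (LINT t:{0..}|lebesgue. t powr (2 * \<mu> + real j) * w t))"

definition cone_weight :: "real \<Rightarrow> (real \<Rightarrow> real) \<Rightarrow> real \<Rightarrow> real \<Rightarrow> real" where
  "cone_weight \<mu> w x t = w t * (t\<^sup>2 - x\<^sup>2) powr (\<mu> - 1 / 2)"

definition cone_inner :: "real \<Rightarrow> (real \<Rightarrow> real) \<Rightarrow> bpoly \<Rightarrow> bpoly \<Rightarrow> real" where
  "cone_inner \<mu> w f g =
     (LINT z:cone|lebesgue.
        bpoly_eval f (fst z) (snd z) * bpoly_eval g (fst z) (snd z) *
        cone_weight \<mu> w (fst z) (snd z))"

definition orth_space :: "real \<Rightarrow> (real \<Rightarrow> real) \<Rightarrow> nat \<Rightarrow> bpoly set" where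
  "orth_space \<mu> w n =
     {P \<in> bpolys_deg_le n. \<forall>g \<in> bpolys_deg_less n. cone_inner \<mu> w P g = 0}"

text \<open>Bases are indexed families; injectivity excludes repeated members.\<close>

definition is_basis_family :: "nat set \<Rightarrow> (nat \<Rightarrow> bpoly) \<Rightarrow> bpoly set \<Rightarrow> bool" where
  "is_basis_family I P U \<longleftrightarrow>
     inj_on P I \<and> bpoly.independent (P ` I) \<and> bpoly.span (P ` I) = U"

text \<open>\<open>P k\<close> has the form \<open>t\<^sup>n\<^sup>-\<^sup>k x\<^sup>k\<close> plus a polynomial of degree at most \<open>n - 1\<close>.\<close>

definition is_monomial_poly :: "nat \<Rightarrow> nat \<Rightarrow> bpoly \<Rightarrow> bool" where
  "is_monomial_poly n k P \<longleftrightarrow> P - bmonom k (n - k) \<in> bpolys_deg_less n"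

definition is_monomial_basis ::
    "real \<Rightarrow> (real \<Rightarrow> real) \<Rightarrow> nat \<Rightarrow> (nat \<Rightarrow> bpoly) \<Rightarrow> bool" where
  "is_monomial_basis \<mu> w n P \<longleftrightarrow>
     (\<forall>k\<le>n. is_monomial_poly n k (P k)) \<and> is_basis_family {..n} P (orth_space \<mu> w n)"

section \<open>The orthogonal polynomials in one variable\<close>

definition is_monic_orth_poly :: "real \<Rightarrow> (real \<Rightarrow> real) \<Rightarrow> nat \<Rightarrow> real poly \<Rightarrow> bool" where
  "is_monic_orth_poly a w m p \<longleftrightarrow>
     degree p = m \<and> lead_coeff p = 1 \<and>
     (\<forall>r. degree r < m \<longrightarrow>
        (LINT t:{0..}|lebesgue. poly p t * poly r t * (t powr a * w t)) = 0)"

definition monic_orth_poly :: "real \<Rightarrow> (real \<Rightarrow> real) \<Rightarrow> nat \<Rightarrow> real poly" where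
  "monic_orth_poly a w m = (THE p. is_monic_orth_poly a w m p)"

text \<open>Standard normalization \<open>C\<^sub>k\<^sup>\<mu>(1) = (2\<mu>)\<^sub>k / k!\<close>, by the three-term recurrence.\<close>

fun gegenbauer :: "real \<Rightarrow> nat \<Rightarrow> real poly" where
  "gegenbauer \<mu> 0 = 1"
| "gegenbauer \<mu> (Suc 0) = [:0, 2 * \<mu>:]"
| "gegenbauer \<mu> (Suc (Suc k)) =
     smult (1 / real (k + 2))
       ([:0, 2 * (real k + 1 + \<mu>):] * gegenbauer \<mu> (Suc k)
        - smult (real k + 2 * \<mu>) (gegenbauer \<mu> k))"

fun chebyshev_T :: "nat \<Rightarrow> real poly" where
  "chebyshev_T 0 = 1"
| "chebyshev_T (Suc 0) = [:0, 1:]"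
| "chebyshev_T (Suc (Suc k)) = [:0, 2:] * chebyshev_T (Suc k) - chebyshev_T k"

definition geg_or_cheb :: "real \<Rightarrow> nat \<Rightarrow> real poly" where
  "geg_or_cheb \<mu> k = (if \<mu> = 0 then chebyshev_T k else gegenbauer \<mu> k)"

lemma degree_geg_or_cheb: "degree (geg_or_cheb \<mu> k) \<le> k"
proof -
  have "degree (chebyshev_T k) \<le> k"
    by (induction k rule: chebyshev_T.induct)
       (auto intro!: degree_diff_le order.trans[OF degree_mult_le])
  moreover have "degree (gegenbauer \<mu> k) \<le> k"
    by (induction \<mu> k rule: gegenbauer.induct)
       (auto intro!: degree_diff_le order.trans[OF degree_mult_le] order.trans[OF degree_smult_le])
  ultimately show ?thesis by (simp add: geg_or_cheb_def)
qed

section \<open>The polynomials on the cone\<close>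

definition S_poly :: "real \<Rightarrow> (real \<Rightarrow> real) \<Rightarrow> nat \<Rightarrow> nat \<Rightarrow> bpoly" where
  "S_poly \<mu> w k n =
     smult (monic_orth_poly (2 * real k + 2 * \<mu>) w (n - k)) (homogenize k (geg_or_cheb \<mu> k))"

lemma bpoly_eval_S_poly:
  assumes "t \<noteq> 0"
  shows "bpoly_eval (S_poly \<mu> w k n) x t =
    poly (monic_orth_poly (2 * real k + 2 * \<mu>) w (n - k)) t * (t ^ k * poly (geg_or_cheb \<mu> k) (x / t))"
  using bpoly_eval_homogenize[OF degree_geg_or_cheb assms]
  by (simp add: S_poly_def bpoly_eval_def)

definition monom_coeff :: "real \<Rightarrow> nat \<Rightarrow> nat \<Rightarrow> real" where
  "monom_coeff \<mu> k j =
     (if \<mu> \<noteq> 0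
      then fact k / 2 ^ k *
           ((real k - 2 * real j + \<mu>) / (pochhammer \<mu> (k - j + 1) * fact j))
      else 1 / 2 ^ k * real (k choose j) * (if k \<noteq> 2 * j then 2 else 1))"

definition V_poly :: "real \<Rightarrow> (real \<Rightarrow> real) \<Rightarrow> nat \<Rightarrow> nat \<Rightarrow> bpoly" where
  "V_poly \<mu> w k n =
     (\<Sum>j = 0..k div 2. bpoly_scale (monom_coeff \<mu> k j) (S_poly \<mu> w (k - 2 * j) n))"

end

theory Submission
  imports Defs
begin

text \<open>
  The substitution \<open>x = s t\<close> gives \<open>\<integral> x\<^sup>i r(t) W = \<integral> s\<^sup>i (1 - s\<^sup>2)\<^sup>\<mu>\<^sup>-\<^sup>1\<^sup>/\<^sup>2 ds \<cdot> \<integral> r(t) t\<^sup>2\<^sup>\<mu>\<^sup>+\<^sup>i w(t) dt\<close>, so that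
  all integrals over the cone reduce to one linear functional in \<open>s\<close> and one in \<open>t\<close>. Integrating
  \<open>S\<^sub>k\<^sub>,\<^sub>n\<close> against \<open>x\<^sup>i r(t)\<close> of degree below \<open>n\<close> then gives zero: for \<open>i < k\<close> by orthogonality of
  the Gegenbauer polynomial, and for \<open>i \<ge> k\<close> by orthogonality of \<open>q\<close>, as the remaining factor
  \<open>r(t) t\<^sup>i\<^sup>-\<^sup>k\<close> has degree below \<open>n - k\<close>. The leading part of \<open>V\<^sub>k\<^sub>,\<^sub>n\<close> is the homogenization of the
  expansion of \<open>x\<^sup>k\<close> in Gegenbauer polynomials. Finally, the inner product is nondegenerate on the
  polynomials of degree below \<open>n\<close>, so an element of the orthogonal space is determined by its
  leading part.

  The cases \<open>\<mu> \<noteq> 0\<close> and \<open>\<mu> = 0\<close> are treated together by passing to the monic Gegenbauer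
  polynomials, whose recurrence and connection coefficients are continuous at \<open>\<mu> = 0\<close>.
\<close>

section \<open>Orthogonal polynomials for a positive functional\<close>

text \<open>Isolates the algebra of the half-line integrals: linearity and positivity on nonzero
  squares yield the monic orthogonal polynomials.\<close>

locale positive_functional =
  fixes \<Lambda> :: "real poly \<Rightarrow> real"
  assumes add: "\<Lambda> (p + q) = \<Lambda> p + \<Lambda> q"
    and smult: "\<Lambda> (smult c p) = c * \<Lambda> p"
    and pos: "p \<noteq> 0 \<Longrightarrow> 0 < \<Lambda> (p * p)"
begin

lemma diff: "\<Lambda> (p - q) = \<Lambda> p - \<Lambda> q"
  using add[of "p - q" q] by simp

text \<open>Gram-Schmidt, one degree at a time. Degree below m is expressed through vanishing
  coefficients, because \<open>degree r < m\<close> would exclude the zero polynomial at m =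
  0.\<close>

lemma ex_orthogonal_projection:
  "\<exists>g. (\<forall>i\<ge>m. coeff g i = 0) \<and> (\<forall>r. (\<forall>i\<ge>m. coeff r i = 0) \<longrightarrow> \<Lambda> ((f - g) * r) = 0)"
proof (induction m arbitrary: f)
  case 0
  have "\<Lambda> 0 = 0" using smult[of 0 0] by simp
  moreover have "r = 0" if "\<forall>i. coeff r i = 0" for r :: "real poly"
    using that by (simp add: poly_eq_iff)
  ultimately show ?case by (intro exI[of _ 0]) force
next
  case (Suc m)
  obtain h where h: "\<forall>i\<ge>m. coeff h i = 0"
      "\<And>r. (\<forall>i\<ge>m. coeff r i = 0) \<Longrightarrow> \<Lambda> ((monom 1 m - h) * r) = 0"
    using Suc.IH[of "monom 1 m"] by blast
  obtain g where g: "\<forall>i\<ge>m. coeff g i = 0"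
      "\<And>r. (\<forall>i\<ge>m. coeff r i = 0) \<Longrightarrow> \<Lambda> ((f - g) * r) = 0"
    using Suc.IH[of f] by blast
  define e where "e = monom 1 m - h"
  have em: "coeff e m = 1" "\<forall>i\<ge>Suc m. coeff e i = 0" using h(1) by (auto simp: e_def)
  have "e \<noteq> 0" using em(1) by auto
  then have epos: "\<Lambda> (e * e) > 0" by (rule pos)
  \<comment> \<open>The Fourier coefficient of f - g along e, the monic orthogonal polynomial of
    degree m.\<close>
  define c where "c = \<Lambda> ((f - g) * e) / \<Lambda> (e * e)"
  show ?case
  proof (intro exI[of _ "g + smult c e"] conjI allI impI)
    fix i assume "Suc m \<le> i"
    then show "coeff (g + smult c e) i = 0" using g(1) em(2) by simp
  next
    fix r :: "real poly" assume r: "\<forall>i\<ge>Suc m. coeff r i = 0"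
    \<comment> \<open>Removing the top coefficient of r leaves an s of degree below m, to which both
      orthogonality relations apply.\<close>
    define s where "s = r - smult (coeff r m) e"
    have s: "\<forall>i\<ge>m. coeff s i = 0"
    proof (intro allI impI)
      fix i assume "m \<le> i"
      then show "coeff s i = 0" using r em by (cases "i = m") (auto simp: s_def)
    qed
    have "(f - (g + smult c e)) * r
      = (f - g) * s + smult (coeff r m) ((f - g) * e)
        - smult c (e * s) - smult c (smult (coeff r m) (e * e))"
      by (simp add: s_def algebra_simps smult_diff_right smult_add_right)
    moreover have "\<Lambda> (e * s) = 0" using h(2)[OF s] by (simp add: e_def)
    ultimately have "\<Lambda> ((f - (g + smult c e)) * r)
        = coeff r m * \<Lambda> ((f - g) * e) - c * (coeff r m * \<Lambda> (e * e))"
      using g(2)[OF s] by (simp add: diff add smult)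
    also have "\<dots> = 0" using epos by (simp add: c_def)
    finally show "\<Lambda> ((f - (g + smult c e)) * r) = 0" .
  qed
qed

text \<open>Existence: the monomial minus its projection. Uniqueness: the leading terms of two
  candidates cancel, so their difference has lower degree and is orthogonal to itself.\<close>

lemma ex1_monic_orthogonal:
  "\<exists>!p. degree p = m \<and> lead_coeff p = 1 \<and> (\<forall>r. degree r < m \<longrightarrow> \<Lambda> (p * r) = 0)"
proof (rule ex_ex1I)
  obtain g where g: "\<forall>i\<ge>m. coeff g i = 0"
      "\<And>r. (\<forall>i\<ge>m. coeff r i = 0) \<Longrightarrow> \<Lambda> ((monom 1 m - g) * r) = 0"
    using ex_orthogonal_projection[of m "monom 1 m"] by blast
  have "degree (monom 1 m - g) = m"
    using g(1) by (intro antisym degree_le le_degree) auto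
  then show "\<exists>p. degree p = m \<and> lead_coeff p = 1 \<and> (\<forall>r. degree r < m \<longrightarrow> \<Lambda> (p * r) = 0)"
    using g by (intro exI[of _ "monom 1 m - g"]) (auto intro!: g(2) coeff_eq_0)
next
  fix p q
  assume p: "degree p = m \<and> lead_coeff p = 1 \<and> (\<forall>r. degree r < m \<longrightarrow> \<Lambda> (p * r) = 0)"
    and q: "degree q = m \<and> lead_coeff q = 1 \<and> (\<forall>r. degree r < m \<longrightarrow> \<Lambda> (q * r) = 0)"
  show "p = q"
  proof (rule ccontr)
    assume "p \<noteq> q"
    then have nz: "p - q \<noteq> 0" by simp
    have "coeff (p - q) m = 0" using p q by auto
    moreover have "degree (p - q) \<le> m" using p q by (intro degree_diff_le) auto
    ultimately have "degree (p - q) < m"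
      using nz by (metis leading_coeff_0_iff le_neq_implies_less)
    then have "\<Lambda> ((p - q) * (p - q)) = 0"
      using p q by (simp add: left_diff_distrib diff)
    with pos[OF nz] show False by simp
  qed
qed

end

section \<open>Monic Gegenbauer polynomials\<close>

text \<open>The coefficient of \<open>P\<^sub>m\<^sub>-\<^sub>1\<close> in \<open>(1 - x\<^sup>2) P\<^sub>m' = geg_slope \<mu> m P\<^sub>m\<^sub>-\<^sub>1 - m x P\<^sub>m\<close>. For \<open>m = 1\<close> the general
  formula is \<open>2\<mu> / (2\<mu>)\<close>, which would be \<open>0\<close> instead of \<open>1\<close> at \<open>\<mu> = 0\<close>.\<close>

definition geg_slope :: "real \<Rightarrow> nat \<Rightarrow> real" where
  "geg_slope \<mu> m =
     (if m \<le> 1 then 1 else real m * (real m - 1 + 2 * \<mu>) / (2 * (real m - 1 + \<mu>)))"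

text \<open>The recurrence coefficient is the usual (m+1)(m+2\<mu>) / (4(m+\<mu>)(m+1+\<mu>)),
  written through \<open>geg_slope\<close> so that m = 0 gives 1 / (2(1+\<mu>)) for \<mu> = 0 as
  well.\<close>

fun monic_geg :: "real \<Rightarrow> nat \<Rightarrow> real poly" where
  "monic_geg \<mu> 0 = 1"
| "monic_geg \<mu> (Suc 0) = [:0, 1:]"
| "monic_geg \<mu> (Suc (Suc m)) = [:0, 1:] * monic_geg \<mu> (Suc m)
     - smult (geg_slope \<mu> (Suc m) / (2 * (real m + 1 + \<mu>))) (monic_geg \<mu> m)"

text \<open>The leading coefficient of \<open>geg_or_cheb\<close>. The Pochhammer formula vanishes
  at \<mu> = 0 for k > 0, so T_k has its own value.\<close>

definition geg_lead :: "real \<Rightarrow> nat \<Rightarrow> real" where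
  "geg_lead \<mu> k =
     (if \<mu> = 0 then if k = 0 then 1 else 2 ^ (k - 1) else 2 ^ k * pochhammer \<mu> k / fact k)"

lemma geg_slope_pos:
  assumes "\<mu> > - 1 / 2"
  shows "geg_slope \<mu> m > 0"
proof (cases "m \<le> 1")
  case False
  then have "real m - 1 \<ge> 1" by simp
  then show ?thesis using assms False by (auto simp: geg_slope_def intro!: divide_pos_pos mult_pos_pos)
qed (simp add: geg_slope_def)

text \<open>Differentiating the recurrence in \<open>monic_geg_deriv_Suc\<close> produces the
  right-hand side as a coefficient. The case m = 0 is separate because
  \<open>geg_slope \<mu> 1\<close> is exceptional.\<close>

lemma geg_slope_Suc_Suc:
  assumes "\<mu> > - 1 / 2"
  shows "geg_slope \<mu> (Suc (Suc m)) = 1 + geg_slope \<mu> (Suc m) * (real m + \<mu>) / (real m + 1 + \<mu>)"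
proof (cases m)
  case 0
  then show ?thesis using assms by (simp add: geg_slope_def field_simps)
next
  case (Suc l)
  define D where "D = real m + \<mu>"
  have D: "D > 0" "real m + 1 + \<mu> = D + 1" "\<mu> = D - real m" using Suc assms by (auto simp: D_def)
  have "geg_slope \<mu> (Suc m) * (real m + \<mu>) = (real m + 1) * (real m + 2 * \<mu>) / 2"
  proof -
    have "geg_slope \<mu> (Suc m) = (real m + 1) * (real m + 2 * \<mu>) / (2 * (real m + \<mu>))"
      using Suc by (simp add: geg_slope_def add.commute)
    then show ?thesis using D(1) by (simp only: D_def[symmetric]) simp
  qed
  moreover have "geg_slope \<mu> (Suc (Suc m)) = (real m + 2) * (real m + 1 + 2 * \<mu>) / (2 * (D + 1))"
    by (simp add: geg_slope_def D_def add_ac)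
  moreover have "(real m + 2) * (real m + 1 + 2 * \<mu>) / (2 * (D + 1))
      = 1 + (real m + 1) * (real m + 2 * \<mu>) / 2 / (D + 1)"
    using D(1) unfolding D(3) by (simp add: field_simps)
  ultimately show ?thesis
    using D(2) by (simp only:)
qed

lemma geg_lead_Suc:
  assumes "\<mu> \<noteq> 0"
  shows "geg_lead \<mu> (Suc k) = geg_lead \<mu> k * (2 * (\<mu> + real k) / (real k + 1))"
  using assms by (simp add: geg_lead_def pochhammer_Suc field_simps)

text \<open>For k > 0 the monic recurrence coefficient is 1/4 and the leading coefficients double.
  For k = 0 the coefficient is 1/2, and the leading coefficients of T_0 and T_1 are both 1.\<close>

lemma chebyshev_T_eq_monic_geg: "chebyshev_T k = smult (geg_lead 0 k) (monic_geg 0 k)"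
proof (induction k rule: chebyshev_T.induct)
  case (3 k)
  show ?case
  proof (cases k)
    case 0
    then show ?thesis unfolding one_pCons by (simp add: geg_lead_def geg_slope_def) (simp add: one_pCons)
  next
    case (Suc l)
    define P Q where "P = monic_geg 0 (Suc k)" and "Q = monic_geg 0 k"
    have "geg_slope 0 (Suc k) / (2 * (real k + 1 + 0)) = 1 / 4"
    proof -
      have "k > 0" using Suc by simp
      then have "geg_slope 0 (Suc k) = (real k + 1) * real k / (2 * real k)"
        by (simp add: geg_slope_def add.commute)
      also have "\<dots> = (real k + 1) / 2" using \<open>k > 0\<close> by simp
      finally have "geg_slope 0 (Suc k) = (real k + 1) / 2" .
      moreover have "a / 2 / (2 * (a + 0)) = 1 / 4" if "a > 0" for a :: real using that by simp
      ultimately show ?thesis by (simp only:)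
    qed
    then have rec: "monic_geg 0 (Suc (Suc k)) = [:0, 1:] * P - smult (1 / 4) Q"
      by (simp only: monic_geg.simps P_def Q_def)
    have lead: "geg_lead 0 (Suc k) = 2 ^ k" "geg_lead 0 k = 2 ^ l" using Suc by (simp_all add: geg_lead_def)
    have "[:0, 2:] = smult 2 [:0, 1 :: real:]" by simp
    then have "chebyshev_T (Suc (Suc k)) = smult (2 ^ Suc k) ([:0, 1:] * P) - smult (2 ^ l) Q"
      by (simp only: chebyshev_T.simps "3.IH" P_def Q_def lead mult_smult_left mult_smult_right smult_smult power_Suc2)
    also have "smult (2 ^ l) Q = smult (2 ^ Suc k) (smult (1 / 4) Q)"
      unfolding Suc by simp
    also have "smult (2 ^ Suc k) ([:0, 1:] * P) - smult (2 ^ Suc k) (smult (1 / 4) Q)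
        = smult (2 ^ Suc k) (monic_geg 0 (Suc (Suc k)))"
      by (simp only: rec smult_diff_right)
    also have "(2::real) ^ Suc k = geg_lead 0 (Suc (Suc k))" by (simp add: geg_lead_def)
    finally show ?thesis .
  qed
next
  case 1
  show ?case unfolding geg_lead_def by simp
next
  case 2
  show ?case unfolding geg_lead_def by simp
qed

lemma gegenbauer_eq_monic_geg:
  assumes "\<mu> > - 1 / 2" "\<mu> \<noteq> 0"
  shows "gegenbauer \<mu> k = smult (geg_lead \<mu> k) (monic_geg \<mu> k)"
  using assms
proof (induction \<mu> k rule: gegenbauer.induct)
  case (3 \<mu> k)
  define P Q where "P = monic_geg \<mu> (Suc k)" and "Q = monic_geg \<mu> k"
  have nz: "real k + \<mu> \<noteq> 0" "real k + 1 + \<mu> > 0" using 3(3,4) by (cases k; simp)+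
  have slope: "geg_slope \<mu> (Suc k) = (real k + 1) * (real k + 2 * \<mu>) / (2 * (real k + \<mu>))"
    using 3(4) by (auto simp: geg_slope_def)
  \<comment> \<open>Facts a and b: scaling the monic recurrence by the leading coefficient gives the
    two coefficients of the Gegenbauer recurrence.\<close>
  have a: "geg_lead \<mu> (Suc (Suc k)) = geg_lead \<mu> (Suc k) * (2 * (real k + 1 + \<mu>)) / (real k + 2)"
    using 3(4) by (simp add: geg_lead_Suc add_ac)
  have b: "geg_lead \<mu> (Suc (Suc k)) * (geg_slope \<mu> (Suc k) / (2 * (real k + 1 + \<mu>)))
      = geg_lead \<mu> k * (real k + 2 * \<mu>) / (real k + 2)"
  proof -
    have "geg_lead \<mu> (Suc (Suc k)) * (geg_slope \<mu> (Suc k) / (2 * (real k + 1 + \<mu>)))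
        = geg_lead \<mu> (Suc k) * geg_slope \<mu> (Suc k) / (real k + 2)"
      unfolding a using nz by simp
    also have "geg_lead \<mu> (Suc k) * geg_slope \<mu> (Suc k) = geg_lead \<mu> k * (real k + 2 * \<mu>)"
      unfolding slope geg_lead_Suc[OF 3(4)] using nz by (simp add: add.commute)
    finally show ?thesis .
  qed
  have IH: "gegenbauer \<mu> (Suc k) = smult (geg_lead \<mu> (Suc k)) P"
      "gegenbauer \<mu> k = smult (geg_lead \<mu> k) Q"
    using 3 by (simp_all add: P_def Q_def)
  have lin: "[:0, 2 * c:] = smult (2 * c) [:0, 1:]" for c :: real by simp
  have "gegenbauer \<mu> (Suc (Suc k)) =
      smult (geg_lead \<mu> (Suc k) * (2 * (real k + 1 + \<mu>)) / (real k + 2)) ([:0, 1:] * P)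
      - smult (geg_lead \<mu> k * (real k + 2 * \<mu>) / (real k + 2)) Q"
    unfolding gegenbauer.simps IH lin
    by (simp only: smult_diff_right mult_smult_left mult_smult_right smult_smult)
      (simp add: mult.commute add.commute)
  also have "\<dots> = smult (geg_lead \<mu> (Suc (Suc k))) (monic_geg \<mu> (Suc (Suc k)))"
    unfolding a[symmetric] b[symmetric] by (simp add: P_def Q_def smult_diff_right)
  finally show ?case .
qed (simp_all add: geg_lead_def)

lemma geg_or_cheb_eq_monic_geg:
  assumes "\<mu> > - 1 / 2"
  shows "geg_or_cheb \<mu> k = smult (geg_lead \<mu> k) (monic_geg \<mu> k)"
  using assms by (simp add: geg_or_cheb_def chebyshev_T_eq_monic_geg gegenbauer_eq_monic_geg)

lemma degree_monic_geg: "degree (monic_geg \<mu> k) \<le> k"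
proof (induction \<mu> k rule: monic_geg.induct)
  case (3 \<mu> m)
  have "degree ([:0, 1:] * monic_geg \<mu> (Suc m)) \<le> Suc (Suc m)"
    using degree_mult_le[of "[:0, 1:]" "monic_geg \<mu> (Suc m)"] 3(1) by simp
  moreover have "degree (smult c (monic_geg \<mu> m)) \<le> Suc (Suc m)" for c
    using degree_smult_le[of c "monic_geg \<mu> m"] 3(2) by simp
  ultimately show ?case unfolding monic_geg.simps by (intro degree_diff_le)
qed simp_all

text \<open>The recurrence is differentiated, and the formulas for the two preceding polynomials
  remove the derivatives that appear.\<close>

lemma monic_geg_deriv_Suc:
  assumes "\<mu> > - 1 / 2"
  shows "[:1, 0, -1:] * pderiv (monic_geg \<mu> (Suc m)) =
    smult (geg_slope \<mu> (Suc m)) (monic_geg \<mu> m)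
    - smult (real (Suc m)) ([:0, 1:] * monic_geg \<mu> (Suc m))"
proof (induction m rule: less_induct)
  case (less m)
  show ?case
  proof (cases m)
    case 0
    then show ?thesis by (simp add: geg_slope_def pderiv_pCons one_pCons)
  next
    case (Suc l)
    define P Q \<gamma> where "P = monic_geg \<mu> m" and "Q = monic_geg \<mu> l"
      and "\<gamma> = geg_slope \<mu> (Suc l) / (2 * (real l + 1 + \<mu>))"
    have pos: "real l + 1 + \<mu> > 0" using assms by simp
    have rec: "monic_geg \<mu> (Suc m) = [:0, 1:] * P - smult \<gamma> Q"
      by (simp only: P_def Q_def Suc \<gamma>_def monic_geg.simps)
    have A: "[:1, 0, -1:] * pderiv P = smult (geg_slope \<mu> m) Q - smult (real m) ([:0, 1:] * P)"
      using less.IH[of l] Suc by (simp only: P_def Q_def lessI)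
    \<comment> \<open>The recurrence eliminates the polynomial below Q, so that only P and Q remain.
      At l = 0 there is none, and the identity holds directly.\<close>
    have B: "[:1, 0, -1:] * pderiv Q =
        smult (real l + 2 * \<mu>) ([:0, 1:] * Q) - smult (2 * (real l + \<mu>)) P"
    proof (cases l)
      case 0
      then show ?thesis by (simp add: P_def Q_def Suc)
    next
      case (Suc i)
      define c where "c = real l + \<mu>"
      have c: "c \<noteq> 0" using Suc assms by (simp add: c_def)
      have r: "P = [:0, 1:] * Q - smult (geg_slope \<mu> l / (2 * c)) (monic_geg \<mu> i)"
        using Suc \<open>m = Suc l\<close> by (simp add: P_def Q_def c_def add.commute)
      have "[:1, 0, -1:] * pderiv Q = smult (geg_slope \<mu> l) (monic_geg \<mu> i) - smult (real l) ([:0, 1:] * Q)"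
        using less.IH[of i] Suc \<open>m = Suc l\<close> by (simp only: Q_def lessI less_SucI)
      moreover have "smult (2 * c) P = smult (2 * c) ([:0, 1:] * Q) - smult (geg_slope \<mu> l) (monic_geg \<mu> i)"
        unfolding r using c by (simp add: smult_diff_right)
      moreover have "smult (real l + 2 * \<mu>) X = smult (2 * c) X - smult (real l) X" for X :: "real poly"
        by (simp add: c_def smult_diff_left[symmetric])
      ultimately show ?thesis unfolding c_def by simp
    qed
    \<comment> \<open>This identity matches the coefficients of P in the final comparison; the next
      one matches those of x Q.\<close>
    have e: "geg_slope \<mu> (Suc m) = 1 + \<gamma> * (2 * (real l + \<mu>))"
    proof -
      have "geg_slope \<mu> (Suc l) * (real l + \<mu>) / (real l + 1 + \<mu>) = \<gamma> * (2 * (real l + \<mu>))"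
      proof -
        have "a * c / D = a / (2 * D) * (2 * c)" for a c D :: real by simp
        then show ?thesis unfolding \<gamma>_def .
      qed
      then show ?thesis using geg_slope_Suc_Suc[OF assms, of l] Suc by simp
    qed
    have \<gamma>: "geg_slope \<mu> m = \<gamma> * (2 * (real l + 1 + \<mu>))" using pos Suc by (simp add: \<gamma>_def)
    have "[:1, 0, -1:] * pderiv (monic_geg \<mu> (Suc m)) =
        [:1, 0, -1:] * P + [:0, 1:] * ([:1, 0, -1:] * pderiv P) - smult \<gamma> ([:1, 0, -1:] * pderiv Q)"
      unfolding rec pderiv_diff pderiv_mult pderiv_smult
      by (rule poly_ext) (simp add: pderiv_pCons algebra_simps)
    also have "\<dots> = smult (geg_slope \<mu> (Suc m)) P - smult (real (Suc m)) ([:0, 1:] * ([:0, 1:] * P - smult \<gamma> Q))"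
      unfolding A B e unfolding \<gamma>
      by (rule poly_ext) (simp add: Suc algebra_simps)
    finally show ?thesis unfolding rec P_def .
  qed
qed

section \<open>Expansion of powers in monic Gegenbauer polynomials\<close>

text \<open>Cancelling \<open>(k - 2 j + \<mu>) (\<mu>)\<^sub>k\<^sub>-\<^sub>2\<^sub>j\<close> between \<open>c\<^sub>k\<^sub>,\<^sub>j\<close> and the leading coefficient of the Gegenbauer
  polynomial leaves an expression that has no singularity at \<open>\<mu> = 0\<close>.\<close>

definition geg_expand :: "real \<Rightarrow> nat \<Rightarrow> nat \<Rightarrow> real" where
  "geg_expand \<mu> k j =
     fact k / (4 ^ j * fact j * fact (k - 2 * j) * pochhammer (\<mu> + real (k - 2 * j) + 1) j)"

lemma geg_expand_eq:
  assumes "\<mu> > - 1 / 2" "2 * j \<le> k"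
  shows "monom_coeff \<mu> k j * geg_lead \<mu> (k - 2 * j) = geg_expand \<mu> k j"
proof -
  obtain m where k: "k = m + 2 * j" using assms(2) by (metis le_Suc_ex add.commute)
  show ?thesis
  proof (cases "\<mu> = 0")
    case True
    have p: "pochhammer (real m + 1) j = fact (m + j) / fact m"
      using pochhammer_product[of m "m + j" "1::real"]
      by (simp add: pochhammer_fact[symmetric] add.commute)
    have "monom_coeff \<mu> k j = (if m = 0 then 1 else 2) / (2 ^ m * 4 ^ j) * (fact k / (fact j * fact (m + j)))"
      using True by (simp add: k monom_coeff_def binomial_fact power_add power_mult) (simp add: mult.commute add.commute)
    moreover have "geg_expand \<mu> k j = fact k / (4 ^ j * (fact j * fact (m + j)))"
      using True p by (simp add: k geg_expand_def)
    ultimately show ?thesis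
      using True by (cases m) (simp_all add: k geg_lead_def)
  next
    case False
    have nz: "pochhammer \<mu> m \<noteq> 0" "\<mu> + real m \<noteq> 0"
    proof -
      \<comment> \<open>No Pochhammer factor vanishes: under the bound on \<mu>, the only integer of
        the form -i that \<mu> could equal is 0.\<close>
      have "\<mu> \<noteq> - real i" for i using False assms(1) by (cases i) auto
      then show "pochhammer \<mu> m \<noteq> 0" "\<mu> + real m \<noteq> 0"
        by (auto simp: pochhammer_eq_0_iff eq_neg_iff_add_eq_0)
    qed
    define Y where "Y = pochhammer (\<mu> + real m + 1) j"
    have "pochhammer \<mu> (m + j + 1) = pochhammer \<mu> m * (\<mu> + real m) * Y"
      using pochhammer_product[of "Suc m" "m + j + 1" \<mu>]
      by (simp add: pochhammer_Suc[of _ m] Y_def add.assoc add.commute[of 1 "real m"])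
    then have "monom_coeff \<mu> k j =
        fact k / (2 ^ m * 4 ^ j) * ((\<mu> + real m) / (pochhammer \<mu> m * (\<mu> + real m) * Y * fact j))"
      using False by (simp add: k monom_coeff_def power_add power_mult add.commute)
    moreover have "geg_expand \<mu> k j = fact k / (4 ^ j * fact j * fact m * Y)"
      by (simp add: k geg_expand_def Y_def)
    moreover have "geg_lead \<mu> (k - 2 * j) = 2 ^ m * pochhammer \<mu> m / fact m"
      using False by (simp add: k geg_lead_def)
    ultimately show ?thesis using nz by simp
  qed
qed

text \<open>Compares coefficients of P_m after the expansion of x^k is multiplied by x: the
  recurrence yields contributions from P_{m-1} and P_{m+1}, and for m = 0 the former is
  absent.\<close>

lemma geg_expand_Suc:
  assumes "\<mu> > - 1 / 2" "Suc k = m + 2 * Suc i"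
  shows "geg_expand \<mu> (Suc k) (Suc i) =
    (if m = 0 then 0 else geg_expand \<mu> k (Suc i))
    + geg_expand \<mu> k i * (geg_slope \<mu> (Suc m) / (2 * (real m + 1 + \<mu>)))"
proof (cases m)
  case 0
  have k: "k = 2 * i + 1" using assms(2) 0 by simp
  have "pochhammer (\<mu> + 1) (Suc i) = (\<mu> + 1) * pochhammer (\<mu> + 2) i"
    by (simp add: pochhammer_rec add.assoc)
  moreover have "pochhammer (\<mu> + 2) i > 0" "\<mu> + 1 > 0"
    using assms(1) by (auto intro!: pochhammer_pos)
  moreover have "fact (Suc k) = 2 * (real i + 1) * fact k" "fact (Suc i) = (real i + 1) * fact i"
    by (simp_all add: k algebra_simps)
  ultimately have "geg_expand \<mu> (Suc k) (Suc i) = 2 * (real i + 1) * fact k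
      / (4 * 4 ^ i * ((real i + 1) * fact i) * ((\<mu> + 1) * pochhammer (\<mu> + 2) i))"
    by (simp add: k geg_expand_def del: fact_Suc)
  moreover have "geg_expand \<mu> k i = fact k / (4 ^ i * fact i * pochhammer (\<mu> + 2) i)"
    by (simp add: k geg_expand_def add.assoc del: fact_Suc)
  moreover have "2 * (real i + 1) * F / (4 * p * ((real i + 1) * f) * (b * Y)) = F / (p * f * Y) * (1 / (2 * b))"
    for F p f b Y :: real by (simp add: divide_divide_eq_right mult_ac) (simp add: divide_simps)
  moreover have "geg_slope \<mu> (Suc m) / (2 * (real m + 1 + \<mu>)) = 1 / (2 * (\<mu> + 1))"
    by (simp add: 0 geg_slope_def add.commute)
  ultimately show ?thesis by (simp only: 0 refl if_True add_0)
next
  case (Suc l)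
  have k: "k = l + 2 * i + 2" using assms(2) Suc by simp
  define b where "b = \<mu> + real l + 1"
  define Y where "Y = pochhammer (b + 2) i"
  have b: "b > 0" using assms(1) by (simp add: b_def)
  then have Y: "Y > 0" by (auto simp: Y_def intro!: pochhammer_pos)
  have p1: "pochhammer (b + 1) (Suc i) = (b + 1) * Y"
    by (simp add: Y_def pochhammer_rec add.assoc)
  have "pochhammer (b + 1) i * (b + 1 + real i) = (b + 1) * Y"
    using p1 by (simp add: pochhammer_Suc)
  then have p2: "pochhammer b (Suc i) = b * ((b + 1) * Y / (b + 1 + real i))"
    using b by (simp add: pochhammer_rec eq_divide_eq)
  \<comment> \<open>A common factor of the three terms; without it a rational identity in i, l and b
    remains.\<close>
  define K where "K = (fact k :: real) / (4 ^ Suc i * fact (Suc i) * fact (Suc l) * ((b + 1) * Y))"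
  have f: "fact (Suc (Suc l)) = (real l + 2) * fact (Suc l)" "fact (Suc l) = (real l + 1) * fact l"
      "fact (Suc i) = (real i + 1) * fact i" "fact (Suc k) = (real k + 1) * fact k"
    by simp_all
  have mb: "\<mu> + real (Suc (Suc l)) + 1 = b + 2" "\<mu> + real (Suc l) + 1 = b + 1" "\<mu> + real l + 1 = b"
    by (simp_all add: b_def)
  have ks: "Suc k - 2 * Suc i = Suc l" "k - 2 * Suc i = l" "k - 2 * i = Suc (Suc l)" by (simp_all add: k)
  have t1: "geg_expand \<mu> (Suc k) (Suc i) = K * (real k + 1)"
    unfolding geg_expand_def K_def ks mb p1 f(4) by (simp add: mult.commute)
  have "real l + 1 > 0" "b + 1 + real i > 0" using b by linarith+
  then have t2: "geg_expand \<mu> k (Suc i) = K * ((real l + 1) * (b + 1 + real i) / b)"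
    unfolding geg_expand_def K_def ks mb p2 f(2) using b Y by (simp add: mult_ac)
  have slope: "geg_slope \<mu> (Suc m) / (2 * (real m + 1 + \<mu>))
      = (real l + 2) * (2 * b - real l - 1) / (4 * b * (b + 1))"
  proof -
    have "geg_slope \<mu> (Suc m) = (real l + 2) * (2 * b - real l - 1) / (2 * b)"
      by (simp add: geg_slope_def Suc b_def add_ac)
    moreover have "real m + 1 + \<mu> = b + 1" by (simp add: Suc b_def)
    ultimately show ?thesis by simp
  qed
  have t3: "geg_expand \<mu> k i * (geg_slope \<mu> (Suc m) / (2 * (real m + 1 + \<mu>)))
      = K * ((real i + 1) * (2 * b - real l - 1) / b)"
  proof -
    have "geg_expand \<mu> k i = K * (4 * (real i + 1) * (b + 1) / (real l + 2))"
    proof -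
      have "real l + 2 > 0" "real i + 1 > 0" "b + 1 > 0" using b by linarith+
      moreover have "F / (p * f * (l * g) * Y) = F / (4 * p * (c * f) * g * (d * Y)) * (4 * c * d / l)"
        if "c > 0" "d > 0" for F p f l g Y c d :: real
        using that by simp
      ultimately show ?thesis
        unfolding geg_expand_def K_def ks mb Y_def[symmetric] f(1,3) power_Suc by blast
    qed
    moreover have "real l + 2 > 0" "b + 1 > 0" using b by linarith+
    moreover have "K * (4 * c * d / q) * (q * e / (4 * b * d)) = K * (c * e / b)"
      if "q > 0" "d > 0" for c d e q :: real
      using that by simp
    ultimately show ?thesis unfolding slope by (simp only:)
  qed
  have "(real k + 1) = (real l + 1) * (b + 1 + real i) / b + (real i + 1) * (2 * b - real l - 1) / b"
    using b by (simp add: k field_simps)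
  moreover have "(if m = 0 then 0 else X) = X" for X :: real using Suc by simp
  ultimately show ?thesis
    unfolding t1 t2 t3 by (simp only: distrib_left)
qed

lemma monom_eq_sum_monic_geg:
  assumes "\<mu> > - 1 / 2"
  shows "monom 1 k = (\<Sum>j\<le>k div 2. smult (geg_expand \<mu> k j) (monic_geg \<mu> (k - 2 * j)))"
proof -
  \<comment> \<open>G vanishes outside the range of the sum, so that the index can run up to k and
    be shifted freely.\<close>
  define G where "G k j = (if 2 * j \<le> k then monic_geg \<mu> (k - 2 * j) else 0)" for k j
  define d where "d = geg_expand \<mu>"
  define \<gamma> where "\<gamma> m = geg_slope \<mu> (Suc m) / (2 * (real m + 1 + \<mu>))" for m
  have "monom 1 k = (\<Sum>j\<le>k. smult (d k j) (G k j))"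
  proof (induction k)
    case 0
    then show ?case by (simp add: G_def d_def geg_expand_def one_pCons monom_0)
  next
    case (Suc k)
    \<comment> \<open>Multiplying the j-th term by x gives a polynomial of one degree more at the
      same index (U) and one of one degree less at the next index (V).\<close>
    define U where "U j = (if 2 * j \<le> k then smult (d k j) (G (Suc k) j) else 0)" for j
    define V where "V j = (case j of 0 \<Rightarrow> 0 | Suc i \<Rightarrow> smult (d k i * \<gamma> (Suc k - 2 * j)) (G (Suc k) j))" for j
    have step: "[:0, 1:] * smult (d k j) (G k j) = U j + V (Suc j)" for j
    proof -
      consider "k < 2 * j" | "k = 2 * j" | m where "k = Suc m + 2 * j"
        by (metis add.commute less_imp_Suc_add linorder_neqE_nat add_Suc_right)
      then show ?thesis
      proof cases
        case (3 m)
        have "monic_geg \<mu> (Suc (Suc m)) = [:0, 1:] * monic_geg \<mu> (Suc m) - smult (\<gamma> m) (monic_geg \<mu> m)"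
          by (simp add: \<gamma>_def)
        then have "[:0, 1:] * monic_geg \<mu> (Suc m) = monic_geg \<mu> (Suc (Suc m)) + smult (\<gamma> m) (monic_geg \<mu> m)"
          by simp
        moreover have "Suc k - 2 * j = Suc (Suc m)" "Suc k - 2 * Suc j = m" "k - 2 * j = Suc m"
          using 3 by simp_all
        ultimately show ?thesis
          using 3 by (simp add: U_def V_def G_def smult_add_right del: monic_geg.simps)
      qed (auto simp: U_def V_def G_def)
    qed
    have split: "smult (d (Suc k) j) (G (Suc k) j) = U j + V j" for j
    proof (cases "2 * j \<le> Suc k")
      case False
      then show ?thesis by (simp add: U_def V_def G_def split: nat.split)
    next
      case True
      show ?thesis
      proof (cases j)
        case 0
        then show ?thesis by (simp add: U_def V_def d_def geg_expand_def)
      next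
        case (Suc i)
        obtain m where m: "Suc k = m + 2 * Suc i" using True Suc by (metis le_Suc_ex add.commute)
        have "d (Suc k) j = (if m = 0 then 0 else d k j) + d k i * \<gamma> m"
          unfolding d_def \<gamma>_def Suc by (rule geg_expand_Suc[OF assms m])
        moreover have "2 * j \<le> k \<longleftrightarrow> m \<noteq> 0" "Suc k - 2 * j = m" using m Suc by auto
        ultimately show ?thesis using Suc by (simp add: U_def V_def smult_add_left)
      qed
    qed
    have "monom 1 (Suc k) = [:0, 1:] * monom (1::real) k"
      by (simp add: monom_Suc)
    also have "\<dots> = (\<Sum>j\<le>k. U j) + (\<Sum>j\<le>k. V (Suc j))"
      unfolding Suc sum_distrib_left step sum.distrib ..
    also have "(\<Sum>j\<le>k. U j) = (\<Sum>j\<le>Suc k. U j)" by (simp add: U_def)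
    also have "(\<Sum>j\<le>k. V (Suc j)) = (\<Sum>j\<le>Suc k. V j)"
      unfolding sum.atMost_Suc_shift by (simp add: V_def)
    finally show ?case by (simp only: sum.distrib[symmetric] split)
  qed
  also have "\<dots> = (\<Sum>j\<le>k div 2. smult (d k j) (G k j))"
    by (rule sum.mono_neutral_right) (auto simp: G_def)
  also have "\<dots> = (\<Sum>j\<le>k div 2. smult (geg_expand \<mu> k j) (monic_geg \<mu> (k - 2 * j)))"
    by (intro sum.cong) (auto simp: G_def d_def)
  finally show ?thesis .
qed

section \<open>Moments of the monic Gegenbauer polynomials\<close>

text \<open>The axiom \<open>divergence\<close> says that the derivative of \<open>p(s) (1 - s\<^sup>2)\<^sup>\<mu>\<^sup>+\<^sup>1\<^sup>/\<^sup>2\<close> has integral zero.\<close>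

locale gegenbauer_functional =
  fixes \<mu> :: real and L :: "real poly \<Rightarrow> real"
  assumes \<mu>: "\<mu> > - 1 / 2"
    and add: "L (p + q) = L p + L q"
    and smult: "L (smult c p) = c * L p"
    and divergence: "L ([:1, 0, -1:] * pderiv p) = (2 * \<mu> + 1) * L ([:0, 1:] * p)"
    and one: "L 1 > 0"
begin

lemma diff: "L (p - q) = L p - L q"
  using add[of "p - q" q] by simp

lemma zero: "L 0 = 0"
  using smult[of 0 0] by simp

text \<open>The axiom \<open>divergence\<close> for p = P_{m+1}, with the derivative removed by
  \<open>monic_geg_deriv_Suc\<close>.\<close>

lemma moment_1:
  "(real m + 2 + 2 * \<mu>) * L (monic_geg \<mu> (Suc m) * monom 1 1) = geg_slope \<mu> (Suc m) * L (monic_geg \<mu> m)"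
proof -
  define X where "X = L (monic_geg \<mu> (Suc m) * monom 1 1)"
  have X: "L ([:0, 1:] * monic_geg \<mu> (Suc m)) = X"
    by (simp add: X_def monom_Suc monom_0 del: monic_geg.simps)
  have "L ([:1, 0, -1:] * pderiv (monic_geg \<mu> (Suc m))) = geg_slope \<mu> (Suc m) * L (monic_geg \<mu> m) - real (Suc m) * X"
    unfolding monic_geg_deriv_Suc[OF \<mu>] diff smult X ..
  then have "(2 * \<mu> + 1) * X = geg_slope \<mu> (Suc m) * L (monic_geg \<mu> m) - real (Suc m) * X"
    by (simp only: divergence X)
  then show ?thesis unfolding X_def[symmetric] by (simp add: algebra_simps)
qed

text \<open>The axiom \<open>divergence\<close> for p = P_{m+1} x^(l+1). It reduces a moment of
  order l+2 to one of P_m of order l+1 and one of P_{m+1} of order l.\<close>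

lemma moment_Suc_Suc:
  "(real m + real l + 3 + 2 * \<mu>) * L (monic_geg \<mu> (Suc m) * monom 1 (Suc (Suc l))) =
   geg_slope \<mu> (Suc m) * L (monic_geg \<mu> m * monom 1 (Suc l))
   + (real l + 1) * L (monic_geg \<mu> (Suc m) * monom 1 l)"
proof -
  define P Q where "P = monic_geg \<mu> (Suc m)" and "Q = monic_geg \<mu> m"
  have x: "[:0, 1:] * monom 1 i = (monom 1 (Suc i) :: real poly)" for i by (simp add: monom_Suc)
  have "pderiv (monom 1 (Suc l)) = smult (real l + 1) (monom 1 l)"
    by (simp add: pderiv_monom smult_monom)
  then have "[:1, 0, -1:] * pderiv (P * monom 1 (Suc l)) =
      ([:1, 0, -1:] * pderiv P) * monom 1 (Suc l)
      + smult (real l + 1) (P * ([:1, 0, -1:] * monom 1 l))"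
    by (simp only: pderiv_mult distrib_left mult_smult_right mult_ac add_ac)
  also have "[:1, 0, -1:] * monom 1 l = monom 1 l - (monom 1 (Suc (Suc l)) :: real poly)"
    by (simp add: monom_Suc)
  also have "([:1, 0, -1:] * pderiv P) * monom 1 (Suc l) =
      smult (geg_slope \<mu> (Suc m)) (Q * monom 1 (Suc l)) - smult (real (Suc m)) (P * monom 1 (Suc (Suc l)))"
    unfolding P_def monic_geg_deriv_Suc[OF \<mu>] Q_def x[symmetric, of "Suc l"]
    by (simp only: left_diff_distrib right_diff_distrib mult_smult_left mult_smult_right mult_ac)
  finally have "(2 * \<mu> + 1) * L ([:0, 1:] * (P * monom 1 (Suc l))) =
      geg_slope \<mu> (Suc m) * L (Q * monom 1 (Suc l)) - real (Suc m) * L (P * monom 1 (Suc (Suc l)))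
      + (real l + 1) * (L (P * monom 1 l) - L (P * monom 1 (Suc (Suc l))))"
    unfolding divergence[symmetric] by (simp only: add diff smult right_diff_distrib)
  also have "[:0, 1:] * (P * monom 1 (Suc l)) = P * monom 1 (Suc (Suc l))"
    unfolding x[symmetric, of "Suc l"] by (simp only: mult_ac)
  finally show ?thesis by (simp add: P_def Q_def algebra_simps)
qed

lemma monic_geg_moment_0: "L (monic_geg \<mu> (Suc k)) = 0"
proof (induction k rule: less_induct)
  case (less k)
  show ?case
  proof (cases k)
    case 0
    have "(2 * \<mu> + 1) * L [:0, 1:] = 0"
      using divergence[of 1] by (simp add: zero)
    then show ?thesis using \<mu> 0 by simp
  next
    case (Suc m)
    have pos: "real m + 2 + 2 * \<mu> > 0" "real m + 1 + \<mu> > 0" using \<mu> by linarith+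
    have "L (monic_geg \<mu> (Suc k)) = L (monic_geg \<mu> (Suc m) * monom 1 1)
        - geg_slope \<mu> (Suc m) / (2 * (real m + 1 + \<mu>)) * L (monic_geg \<mu> m)"
      by (simp add: Suc diff smult monom_Suc monom_0)
    also have "L (monic_geg \<mu> (Suc m) * monom 1 1) = geg_slope \<mu> (Suc m) / (real m + 2 + 2 * \<mu>) * L (monic_geg \<mu> m)"
      using moment_1[of m] pos(1) by (simp add: field_simps)
    finally have *: "L (monic_geg \<mu> (Suc k)) = \<dots> - geg_slope \<mu> (Suc m) / (2 * (real m + 1 + \<mu>)) * L (monic_geg \<mu> m)" .
    show ?thesis
    \<comment> \<open>For m = 0 the two factors coincide and cancel; for m > 0 they differ, but
      L(P_m) is zero by induction.\<close>
    proof (cases m)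
      case 0
      then show ?thesis using * by simp
    next
      case (Suc i)
      then show ?thesis using * less[of i] \<open>k = Suc m\<close> by simp
    qed
  qed
qed

text \<open>Induction on k, then on i: the moment relations lead to smaller k or i, ending in
  \<open>monic_geg_moment_0\<close>.\<close>

lemma monic_geg_orthogonal:
  assumes "i < k"
  shows "L (monic_geg \<mu> k * monom 1 i) = 0"
  using assms
proof (induction k arbitrary: i)
  case (Suc m)
  from \<open>i < Suc m\<close> show ?case
  proof (induction i rule: less_induct)
    case (less i)
    consider "i = 0" | "i = 1" | l where "i = Suc (Suc l)"
      by (metis One_nat_def not0_implies_Suc)
    then show ?case
    proof cases
      case 1
      then show ?thesis using monic_geg_moment_0[of m] by (simp add: monom_0)
    next
      case 2
      then have "L (monic_geg \<mu> m) = 0" using Suc.IH[of 0] less.prems by (simp add: monom_0)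
      then show ?thesis using moment_1[of m] \<mu> 2 by simp
    next
      case (3 l)
      have "L (monic_geg \<mu> m * monom 1 (Suc l)) = 0" using Suc.IH[of "Suc l"] less.prems 3 by simp
      moreover have "L (monic_geg \<mu> (Suc m) * monom 1 l) = 0" using less 3 by simp
      moreover have "real m + real l + 3 + 2 * \<mu> > 0" using \<mu> by linarith
      ultimately show ?thesis using moment_Suc_Suc[of m l] 3 by simp
    qed
  qed
qed simp

text \<open>In the moment relation for i = k the lower-order term vanishes by orthogonality, so each
  top moment is a positive multiple of the preceding one.\<close>

lemma monic_geg_top_moment_pos: "L (monic_geg \<mu> k * monom 1 k) > 0"
proof (induction k)
  case 0
  then show ?case using one by (simp add: monom_0 one_pCons)
next
  case (Suc m)
  show ?case
  proof (cases m)
    case 0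
    have "(2 + 2 * \<mu>) * L (monic_geg \<mu> (Suc 0) * monom 1 1) > 0"
      using moment_1[of 0] one by (simp add: geg_slope_def)
    moreover have "2 + 2 * \<mu> > 0" using \<mu> by simp
    ultimately show ?thesis using 0 by (simp only: zero_less_mult_pos One_nat_def)
  next
    case (Suc l)
    have "L (monic_geg \<mu> (Suc m) * monom 1 l) = 0" using Suc by (intro monic_geg_orthogonal) simp
    then have "(real m + real l + 3 + 2 * \<mu>) * L (monic_geg \<mu> (Suc m) * monom 1 (Suc (Suc l))) > 0"
      unfolding moment_Suc_Suc using Suc.IH geg_slope_pos[OF \<mu>] Suc by simp
    moreover have "real m + real l + 3 + 2 * \<mu> > 0" using \<mu> by linarith
    ultimately show ?thesis using Suc by (simp only: zero_less_mult_pos)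
  qed
qed

end

section \<open>Integration over the cone\<close>

text \<open>The weight w is only Lebesgue measurable. Integrands are replaced by Borel functions up
  to null sets, and completeness transfers measurability back.\<close>

lemma borel_measurable_lebesgue_AE_cong:
  fixes f g :: "'a :: euclidean_space \<Rightarrow> real"
  assumes "g \<in> borel_measurable borel" "AE x in lborel. f x = g x"
  shows "f \<in> borel_measurable lebesgue"
proof (rule measurableI)
  fix A :: "real set" assume A: "A \<in> sets borel"
  have "g -` A \<in> sets lebesgue" using measurable_sets[OF assms(1) A] by simp
  moreover have "AE x in lebesgue. x \<in> g -` A \<longleftrightarrow> x \<in> f -` A"
    using AE_completion[OF assms(2)] by eventually_elim simp
  ultimately show "f -` A \<inter> space lebesgue \<in> sets lebesgue"
    by (simp add: completion.in_sets_AE[where A = "g -` A"])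
qed simp

lemma AE_lborel_snd:
  assumes "AE t in lborel. P (t :: real)"
  shows "AE z in (lborel :: (real \<times> real) measure). P (snd z)"
proof -
  obtain N where N: "{t. \<not> P t} \<subseteq> N" "N \<in> null_sets lborel"
    using assms by (auto simp: eventually_ae_filter)
  have "UNIV \<times> N \<in> null_sets (lborel \<Otimes>\<^sub>M lborel :: (real \<times> real) measure)"
    using N(2) lborel.emeasure_pair_measure_Times[of UNIV lborel N] by (auto simp: null_sets_def)
  then show ?thesis unfolding lborel_prod[symmetric] using N(1) by (intro AE_I') auto
qed

text \<open>The substitution x = s t for fixed t > 0: its Jacobian t cancels the factor 1/t, and
  Fubini separates the integrals.\<close>

lemma cone_integral_product:
  fixes \<phi> v :: "real \<Rightarrow> real"
  assumes [measurable]: "\<phi> \<in> borel_measurable borel"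
    and \<phi>: "set_integrable lebesgue {-1..1} \<phi>" and v: "set_integrable lebesgue {0..} v"
  shows "set_integrable lebesgue cone (\<lambda>z. \<phi> (fst z / snd z) * (v (snd z) / snd z))" (is ?I)
    and "(LINT z:cone|lebesgue. \<phi> (fst z / snd z) * (v (snd z) / snd z)) =
      (LINT s:{-1..1}|lebesgue. \<phi> s) * (LINT t:{0..}|lebesgue. v t)" (is ?E)
proof -
  define f where "f s = indicator {-1..1} s * \<phi> s" for s
  have fm[measurable]: "f \<in> borel_measurable borel" unfolding f_def by measurable
  have fi: "integrable lborel f"
    using \<phi> unfolding set_integrable_def by (subst integrable_completion[symmetric]) (simp_all add: f_def[abs_def])
  have "(\<lambda>t. indicator {0..} t * v t) \<in> borel_measurable lebesgue"
    using v unfolding set_integrable_def by (auto dest: borel_measurable_integrable)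
  \<comment> \<open>A Borel version of v cut off to t \<ge> 0, as Fubini is applied to the product
    of Borel measures.\<close>
  then obtain g where gm[measurable]: "g \<in> borel_measurable lborel"
      and g: "AE t in lborel. indicator {0..} t * v t = g t"
    using completion_ex_borel_measurable_real by blast
  have gi: "integrable lborel g" and gI: "(LINT t:{0..}|lebesgue. v t) = integral\<^sup>L lborel g"
  proof -
    have "integrable lebesgue g"
      using v unfolding set_integrable_def
      by (rule integrable_cong_AE_imp) (use AE_completion[OF g] in \<open>auto simp: eq_commute intro: measurable_completion\<close>)
    then show "integrable lborel g" by (simp add: integrable_completion)
    have "(LINT t:{0..}|lebesgue. v t) = integral\<^sup>L lebesgue g"
      unfolding set_lebesgue_integral_def
      using v AE_completion[OF g] unfolding set_integrable_def
      by (intro integral_cong_AE) (auto intro: measurable_completion)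
    then show "(LINT t:{0..}|lebesgue. v t) = integral\<^sup>L lborel g" by (simp add: integral_completion)
  qed
  \<comment> \<open>Coordinates in the order (t, x), so that the inner integral is over x; the null
    line t = 0 is removed.\<close>
  define H where "H = (\<lambda>z :: real \<times> real. indicator {0<..} (fst z) * (f (snd z / fst z) * (g (fst z) / fst z)))"
  have Hm[measurable]: "H \<in> borel_measurable (lborel \<Otimes>\<^sub>M lborel)"
    unfolding H_def by measurable
  have inner: "integrable lborel (\<lambda>x. H (t, x))"
      "(\<integral>x. H (t, x) \<partial>lborel) = indicator {0<..} t * g t * integral\<^sup>L lborel f"
      "(\<integral>x. norm (H (t, x)) \<partial>lborel) = indicator {0<..} t * \<bar>g t\<bar> * (\<integral>x. \<bar>f x\<bar> \<partial>lborel)" for t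
  proof -
    have "integrable lborel (\<lambda>x. H (t, x)) \<and>
      (\<integral>x. H (t, x) \<partial>lborel) = indicator {0<..} t * g t * integral\<^sup>L lborel f \<and>
      (\<integral>x. norm (H (t, x)) \<partial>lborel) = indicator {0<..} t * \<bar>g t\<bar> * (\<integral>x. \<bar>f x\<bar> \<partial>lborel)"
    proof (cases "t > 0")
      case True
      have "integrable lborel (\<lambda>x. f (x / t))"
        using lborel_integrable_real_affine[OF fi, of "1 / t" 0] True by simp
      moreover have "(\<integral>x. h (x / t) \<partial>lborel) = t * integral\<^sup>L lborel h" for h :: "real \<Rightarrow> real"
        using lborel_integral_real_affine[of "1 / t" h 0] True by (simp add: field_simps)
      moreover from this[of "\<lambda>s. \<bar>f s\<bar>"]
      have "(\<integral>x. \<bar>f (x / t)\<bar> \<partial>lborel) = t * (\<integral>x. \<bar>f x\<bar> \<partial>lborel)" .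
      ultimately show ?thesis
        using True by (simp add: H_def abs_mult)
    qed (simp add: H_def)
    then show "integrable lborel (\<lambda>x. H (t, x))"
      "(\<integral>x. H (t, x) \<partial>lborel) = indicator {0<..} t * g t * integral\<^sup>L lborel f"
      "(\<integral>x. norm (H (t, x)) \<partial>lborel) = indicator {0<..} t * \<bar>g t\<bar> * (\<integral>x. \<bar>f x\<bar> \<partial>lborel)" by auto
  qed
  have ind: "integrable lborel (\<lambda>t. indicator {0<..} t * h t)" if "integrable lborel h" for h :: "real \<Rightarrow> real"
    using integrable_mult_indicator[OF _ that, of "{0<..}"] by simp
  have Hi: "integrable (lborel \<Otimes>\<^sub>M lborel) H"
    using ind[OF integrable_abs[OF gi]]
    by (intro lborel_pair.Fubini_integrable) (simp_all add: inner inner(3)[unfolded real_norm_def])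
  have "integral\<^sup>L (lborel \<Otimes>\<^sub>M lborel) H = (\<integral>t. indicator {0<..} t * g t \<partial>lborel) * integral\<^sup>L lborel f"
    using lborel_pair.integral_fst'[OF Hi] by (simp add: inner)
  also have "(\<integral>t. indicator {0<..} t * g t \<partial>lborel) = integral\<^sup>L lborel g"
  proof (rule integral_cong_AE)
    show "AE t in lborel. indicator {0<..} t * g t = g t"
      using g AE_lborel_singleton[of 0] by eventually_elim (auto split: split_indicator)
  qed (use gm in measurable)
  finally have HI: "integral\<^sup>L (lborel \<Otimes>\<^sub>M lborel) H = integral\<^sup>L lborel g * integral\<^sup>L lborel f" .
  define H' where "H' = (\<lambda>z. H (snd z, fst z))"
  have H'i: "integrable lborel H'"
    using lborel_pair.integrable_product_swap[OF Hi] unfolding lborel_prod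
    by (simp add: H'_def case_prod_unfold)
  then have H'm[measurable]: "H' \<in> borel_measurable borel"
    by (auto dest: borel_measurable_integrable)
  have H'I: "integral\<^sup>L lborel H' = integral\<^sup>L lborel f * integral\<^sup>L lborel g"
    using lborel_pair.integral_product_swap[OF Hm] HI unfolding lborel_prod
    by (simp add: H'_def case_prod_unfold)
  let ?F = "\<lambda>z. indicat_real cone z *\<^sub>R (\<phi> (fst z / snd z) * (v (snd z) / snd z))"
  have ae: "AE z in lborel. ?F z = H' z"
    using AE_lborel_snd[OF g]
  proof eventually_elim
    case (elim z)
    then show ?case
      by (cases z; cases "snd z > 0")
        (auto simp: H'_def H_def f_def cone_def indicator_def abs_le_iff field_simps split: if_splits)
  qed
  have Fm: "?F \<in> borel_measurable lebesgue"
    by (rule borel_measurable_lebesgue_AE_cong[OF H'm ae])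
  have H'l: "H' \<in> borel_measurable lebesgue" by (rule measurable_completion) simp
  show ?I unfolding set_integrable_def
    by (rule integrable_cong_AE_imp[of _ H'])
      (use H'i Fm AE_completion[OF ae] in \<open>simp_all add: integrable_completion eq_commute\<close>)
  have "integral\<^sup>L lebesgue ?F = integral\<^sup>L lebesgue H'"
    by (rule integral_cong_AE[OF Fm H'l AE_completion[OF ae]])
  also have "\<dots> = integral\<^sup>L lborel f * integral\<^sup>L lborel g"
    using H'I by (simp add: integral_completion)
  also have "integral\<^sup>L lborel f = (LINT s:{-1..1}|lebesgue. \<phi> s)"
    unfolding set_lebesgue_integral_def by (subst integral_completion[symmetric]) (simp_all add: f_def[abs_def])
  finally show ?E unfolding set_lebesgue_integral_def[of lebesgue cone] gI .
qed

section \<open>The Gegenbauer weight on the interval [-1, 1]\<close>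

lemma set_integrable_geg_weight:
  fixes \<mu> :: real
  assumes "\<mu> > - 1 / 2"
  shows "set_integrable lebesgue {-1..1} (\<lambda>s. (1 - s\<^sup>2) powr (\<mu> - 1 / 2))"
proof -
  define a where "a = \<mu> - 1 / 2"
  have a: "a + 1 > 0" using assms by (simp add: a_def)
  have i1: "set_integrable lebesgue {-1..1} (\<lambda>s. (1 - s) powr a)"
  proof (rule nonnegative_absolutely_integrable_1)
    have "((\<lambda>s. (1 - s) powr a) has_integral
        (- ((1 - 1) powr (a + 1)) / (a + 1) - (- ((1 - (-1)) powr (a + 1)) / (a + 1)))) {-1..1}"
    \<comment> \<open>Continuity up to the endpoints, from a + 1 > 0, suffices here; the derivative
      may be singular at s = 1.\<close>
    proof (rule fundamental_theorem_of_calculus_interior)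
      show "continuous_on {-1..1} (\<lambda>s. - ((1 - s) powr (a + 1)) / (a + 1))"
        using a by (intro continuous_intros continuous_on_powr') auto
      fix s :: real assume "s \<in> {-1<..<1}"
      then show "((\<lambda>s. - ((1 - s) powr (a + 1)) / (a + 1)) has_vector_derivative (1 - s) powr a) (at s)"
        unfolding has_real_derivative_iff_has_vector_derivative[symmetric]
        using a by (auto intro!: derivative_eq_intros)
    qed simp
    then show "(\<lambda>s. (1 - s) powr a) integrable_on {-1..1}" by blast
  qed simp
  have i2: "set_integrable lebesgue {-1..1} (\<lambda>s. (1 + s) powr a)"
  proof (rule nonnegative_absolutely_integrable_1)
    have "((\<lambda>s. (1 + s) powr a) has_integral
        ((1 + 1) powr (a + 1) / (a + 1) - (1 + (-1)) powr (a + 1) / (a + 1))) {-1..1}"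
    proof (rule fundamental_theorem_of_calculus_interior)
      show "continuous_on {-1..1} (\<lambda>s. (1 + s) powr (a + 1) / (a + 1))"
        using a by (intro continuous_intros continuous_on_powr') auto
      fix s :: real assume "s \<in> {-1<..<1}"
      then show "((\<lambda>s. (1 + s) powr (a + 1) / (a + 1)) has_vector_derivative (1 + s) powr a) (at s)"
        unfolding has_real_derivative_iff_has_vector_derivative[symmetric]
        using a by (auto intro!: derivative_eq_intros)
    qed simp
    then show "(\<lambda>s. (1 + s) powr a) integrable_on {-1..1}" by blast
  qed simp
  \<comment> \<open>C bounds u^a on [1, 2]. On each half of [-1, 1] one of 1 - s and 1 + s lies in
    [1, 2], which leaves only the power at the nearer endpoint.\<close>
  define C where "C = max 1 ((2::real) powr a)"
  have C: "u powr a \<le> C" if "1 \<le> u" "u \<le> 2" for u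
  proof (cases "a \<ge> 0")
    case True
    then show ?thesis using that powr_mono2[of a u 2] by (simp add: C_def)
  next
    case False
    then show ?thesis using that powr_mono2'[of a 1 u] by (simp add: C_def)
  qed
  have bound: "(1 - s\<^sup>2) powr a \<le> C * ((1 - s) powr a + (1 + s) powr a)" if "s \<in> {-1..1}" for s
  proof -
    have "(1 - s\<^sup>2) = (1 - s) * (1 + s)" by (simp add: power2_eq_square algebra_simps)
    then have e: "(1 - s\<^sup>2) powr a = (1 - s) powr a * (1 + s) powr a"
      using that by (simp add: powr_mult)
    have C0: "C \<ge> 0" by (simp add: C_def)
    show ?thesis
    proof (cases "s \<ge> 0")
      case True
      then have "(1 - s\<^sup>2) powr a \<le> C * (1 - s) powr a"
        unfolding e using C[of "1 + s"] that by (simp add: mult_left_mono mult.commute[of C])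
      also have "\<dots> \<le> C * ((1 - s) powr a + (1 + s) powr a)"
        using C0 by (intro mult_left_mono) auto
      finally show ?thesis .
    next
      case False
      then have "(1 - s\<^sup>2) powr a \<le> C * (1 + s) powr a"
        unfolding e using C[of "1 - s"] that by (simp add: mult_right_mono)
      also have "\<dots> \<le> C * ((1 - s) powr a + (1 + s) powr a)"
        using C0 by (intro mult_left_mono) auto
      finally show ?thesis .
    qed
  qed
  have "set_integrable lebesgue {-1..1} (\<lambda>s. C * ((1 - s) powr a + (1 + s) powr a))"
    using i1 i2 by simp
  then have "set_integrable lebesgue {-1..1} (\<lambda>s. (1 - s\<^sup>2) powr a)"
  proof (rule set_integrable_bound)
    show "set_borel_measurable lebesgue {-1..1} (\<lambda>s. (1 - s\<^sup>2) powr a)"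
      unfolding set_borel_measurable_def by (intro measurable_completion) simp
    show "AE s in lebesgue. s \<in> {-1..1} \<longrightarrow>
        norm ((1 - s\<^sup>2) powr a) \<le> norm (C * ((1 - s) powr a + (1 + s) powr a))"
    proof (rule AE_I2, rule impI)
      fix s :: real assume "s \<in> {-1..1}"
      from bound[OF this] show "norm ((1 - s\<^sup>2) powr a) \<le> norm (C * ((1 - s) powr a + (1 + s) powr a))"
        by simp
    qed
  qed
  then show ?thesis by (simp only: a_def)
qed

definition geg_integral :: "real \<Rightarrow> real poly \<Rightarrow> real" where
  "geg_integral \<mu> p = (LINT s:{-1..1}|lebesgue. poly p s * (1 - s\<^sup>2) powr (\<mu> - 1 / 2))"

lemma set_integrable_poly_geg_weight:
  fixes \<mu> :: real
  assumes "\<mu> > - 1 / 2"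
  shows "set_integrable lebesgue {-1..1} (\<lambda>s. poly p s * (1 - s\<^sup>2) powr (\<mu> - 1 / 2))"
proof (rule absolutely_integrable_bounded_measurable_product_real)
  show "poly p \<in> borel_measurable (lebesgue_on {-1..1})"
    by (intro continuous_imp_measurable_on_sets_lebesgue continuous_on_poly continuous_on_id) simp
  show "bounded (poly p ` {-1..1})"
    by (intro compact_imp_bounded compact_continuous_image continuous_on_poly continuous_on_id) simp
qed (use set_integrable_geg_weight[OF assms] in auto)

lemma set_integral_pos:
  fixes f :: "real \<Rightarrow> real"
  assumes int: "set_integrable lebesgue A f" and nonneg: "\<And>x. x \<in> A \<Longrightarrow> 0 \<le> f x"
    and nz: "\<not> (AE x in lebesgue. x \<in> A \<longrightarrow> f x = 0)"
  shows "0 < (LINT x:A|lebesgue. f x)"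
proof -
  have nn: "AE x in lebesgue. 0 \<le> indicat_real A x *\<^sub>R f x"
    using nonneg by (intro AE_I2) (simp add: indicator_def)
  have "(LINT x:A|lebesgue. f x) \<noteq> 0"
  proof
    assume "(LINT x:A|lebesgue. f x) = 0"
    then have "AE x in lebesgue. indicat_real A x *\<^sub>R f x = 0"
      using integral_nonneg_eq_0_iff_AE[OF int[unfolded set_integrable_def] nn]
      unfolding set_lebesgue_integral_def by simp
    then have "AE x in lebesgue. x \<in> A \<longrightarrow> f x = 0"
      by eventually_elim (auto simp: indicator_def)
    with nz show False ..
  qed
  moreover have "0 \<le> (LINT x:A|lebesgue. f x)"
    unfolding set_lebesgue_integral_def using nn by (rule integral_nonneg_AE)
  ultimately show ?thesis by simp
qed

lemma gegenbauer_functional_geg_integral: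
  assumes \<mu>: "\<mu> > - 1 / 2"
  shows "gegenbauer_functional \<mu> (geg_integral \<mu>)"
proof
  note int = set_integrable_poly_geg_weight[OF \<mu>]
  show "geg_integral \<mu> (p + q) = geg_integral \<mu> p + geg_integral \<mu> q" for p q
    unfolding geg_integral_def using int[of p] int[of q] by (simp add: distrib_right)
  show "geg_integral \<mu> (smult c p) = c * geg_integral \<mu> p" for c p
    unfolding geg_integral_def by (simp add: mult.assoc)
  show "geg_integral \<mu> ([:1, 0, -1:] * pderiv p) = (2 * \<mu> + 1) * geg_integral \<mu> ([:0, 1:] * p)" for p
  proof -
    \<comment> \<open>The derivative of p(s) (1 - s^2)^(\<mu>+1/2) is r times the weight. Its
      primitive is continuous and zero at both ends, as \<mu> + 1/2 > 0.\<close>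
    define r where "r = [:1, 0, -1:] * pderiv p - smult (2 * \<mu> + 1) ([:0, 1:] * p)"
    have "((\<lambda>s. poly r s * (1 - s\<^sup>2) powr (\<mu> - 1 / 2)) has_integral
        (poly p 1 * (1 - 1\<^sup>2) powr (\<mu> + 1 / 2) - poly p (-1) * (1 - (-1)\<^sup>2) powr (\<mu> + 1 / 2))) {-1..1}"
    proof (rule fundamental_theorem_of_calculus_interior)
      show "continuous_on {-1..1} (\<lambda>s. poly p s * (1 - s\<^sup>2) powr (\<mu> + 1 / 2))"
        using \<mu> by (intro continuous_intros continuous_on_powr') (auto simp: abs_square_le_1 abs_le_iff)
      fix s :: real assume s: "s \<in> {-1<..<1}"
      then have pos: "1 - s\<^sup>2 > 0" by (simp add: abs_square_less_1 abs_less_iff)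
      have "((\<lambda>s. poly p s * (1 - s\<^sup>2) powr (\<mu> + 1 / 2)) has_real_derivative
          poly (pderiv p) s * (1 - s\<^sup>2) powr (\<mu> + 1 / 2)
          + (\<mu> + 1 / 2) * (1 - s\<^sup>2) powr (\<mu> + 1 / 2 - 1) * (- (2 * s)) * poly p s) (at s)"
        using pos by (auto intro!: derivative_eq_intros)
      moreover have e: "(1 - s\<^sup>2) powr (\<mu> + 1 / 2) = (1 - s\<^sup>2) * (1 - s\<^sup>2) powr (\<mu> - 1 / 2)"
        using pos by (simp add: powr_mult_base add.commute)
      moreover have "\<mu> + 1 / 2 - 1 = \<mu> - 1 / 2" by simp
      then have "poly (pderiv p) s * (1 - s\<^sup>2) powr (\<mu> + 1 / 2)
          + (\<mu> + 1 / 2) * (1 - s\<^sup>2) powr (\<mu> + 1 / 2 - 1) * (- (2 * s)) * poly p s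
          = poly r s * (1 - s\<^sup>2) powr (\<mu> - 1 / 2)"
        unfolding e by (simp add: r_def algebra_simps power2_eq_square)
      ultimately show "((\<lambda>s. poly p s * (1 - s\<^sup>2) powr (\<mu> + 1 / 2)) has_vector_derivative
          poly r s * (1 - s\<^sup>2) powr (\<mu> - 1 / 2)) (at s)"
        unfolding has_real_derivative_iff_has_vector_derivative[symmetric]
        by simp
    qed simp
    then have "((\<lambda>s. poly r s * (1 - s\<^sup>2) powr (\<mu> - 1 / 2)) has_integral 0) {-1..1}" by simp
    then have "geg_integral \<mu> r = 0"
      unfolding geg_integral_def set_lebesgue_integral_eq_integral(2)[OF int] by (rule integral_unique)
    moreover have "geg_integral \<mu> r = geg_integral \<mu> ([:1, 0, -1:] * pderiv p)
        - (2 * \<mu> + 1) * geg_integral \<mu> ([:0, 1:] * p)"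
      using int[of "[:1, 0, -1:] * pderiv p"] int[of "[:0, 1:] * p"]
      unfolding geg_integral_def r_def by (simp add: left_diff_distrib mult.assoc del: mult_pCons_left)
    ultimately show ?thesis by simp
  qed
  show "geg_integral \<mu> 1 > 0"
    unfolding geg_integral_def
  proof (rule set_integral_pos[OF int])
    show "\<not> (AE s in lebesgue. s \<in> {-1..1} \<longrightarrow> poly 1 s * (1 - s\<^sup>2) powr (\<mu> - 1 / 2) = 0)"
    proof
      assume "AE s in lebesgue. s \<in> {-1..1} \<longrightarrow> poly 1 s * (1 - s\<^sup>2) powr (\<mu> - 1 / 2) = 0"
      \<comment> \<open>The weight vanishes only at s = -1 and s = 1.\<close>
      then have "AE s in lebesgue. s \<notin> {-1<..<1 :: real}"
        by eventually_elim (auto simp: abs_square_eq_1 power2_eq_1_iff)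
      then have "{-1<..<1 :: real} \<in> null_sets lebesgue"
        by (subst completion.null_sets_iff_AE) auto
      then show False by (auto simp: null_sets_def)
    qed
  qed simp_all
qed (rule \<mu>)

section \<open>The weight on the half-line\<close>

locale cone_weight_setting =
  fixes \<mu> :: real and w :: "real \<Rightarrow> real"
  assumes \<mu>: "\<mu> > - 1 / 2" and weight: "weight_on_halfline \<mu> w"
begin

text \<open>The exponent is split into 2\<mu> and a natural number, so that moving powers of t
  between polynomial and weight is a shift of k.\<close>

definition half_integral :: "nat \<Rightarrow> real poly \<Rightarrow> real" where
  "half_integral k p = (LINT t:{0..}|lebesgue. poly p t * (t powr (2 * \<mu> + real k) * w t))"

text \<open>At t = 0 both sides are 0, because \<open>0 powr a\<close> is 0 for every a.\<close>

lemma power_mult_powr: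
  assumes "t \<ge> 0"
  shows "t ^ i * t powr a = t powr (a + real i)"
  using assms by (cases "t = 0") (simp_all add: powr_add powr_realpow)

lemma half_integrable:
  "set_integrable lebesgue {0..} (\<lambda>t. poly p t * (t powr (2 * \<mu> + real k) * w t))"
proof -
  let ?h = "\<lambda>i t. indicator {0..} t *\<^sub>R (t powr (2 * \<mu> + real (k + i)) * w t)"
  have "integrable lebesgue (?h i)" for i
    using weight unfolding weight_on_halfline_def set_integrable_def by blast
  then have "integrable lebesgue (\<lambda>t. \<Sum>i\<le>degree p. coeff p i * ?h i t)"
    by (intro Bochner_Integration.integrable_sum integrable_mult_right)
  also have "(\<lambda>t. \<Sum>i\<le>degree p. coeff p i * ?h i t) =
      (\<lambda>t. indicator {0..} t *\<^sub>R (poly p t * (t powr (2 * \<mu> + real k) * w t)))"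
  proof
    fix t :: real
    show "(\<Sum>i\<le>degree p. coeff p i * ?h i t) =
        indicator {0..} t *\<^sub>R (poly p t * (t powr (2 * \<mu> + real k) * w t))"
    proof (cases "t \<ge> 0")
      case True
      have "t powr (2 * \<mu> + real (k + i)) = t ^ i * t powr (2 * \<mu> + real k)" for i
        using power_mult_powr[OF True, of i "2 * \<mu> + real k"] by (simp add: add.assoc)
      then show ?thesis
        using True by (simp add: poly_altdef sum_distrib_right mult.assoc)
    qed simp
  qed
  finally show ?thesis unfolding set_integrable_def .
qed

lemma half_integral_mult_monom:
  "half_integral k (p * monom 1 i) = half_integral (k + i) p"
  unfolding half_integral_def
proof (rule set_lebesgue_integral_cong)
  show "\<forall>t. t \<in> {0..} \<longrightarrow> poly (p * monom 1 i) t * (t powr (2 * \<mu> + real k) * w t) =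
      poly p t * (t powr (2 * \<mu> + real (k + i)) * w t)"
    by (simp add: poly_monom mult.assoc power_mult_powr[symmetric] add.assoc[symmetric] mult.left_commute)
qed simp

text \<open>If the integral of p^2 were zero, the weight would vanish almost everywhere off the
  finitely many roots of p, against the positivity of its moments.\<close>

lemma positive_half_integral: "positive_functional (half_integral k)"
proof
  show "half_integral k (p + q) = half_integral k p + half_integral k q" for p q
    unfolding half_integral_def using half_integrable[of p k] half_integrable[of q k]
    by (simp add: distrib_right)
  show "half_integral k (smult c p) = c * half_integral k p" for c p
    unfolding half_integral_def by (simp add: mult.assoc)
  fix p :: "real poly" assume "p \<noteq> 0"
  show "half_integral k (p * p) > 0"
    unfolding half_integral_def
  proof (rule set_integral_pos[OF half_integrable])
    show "0 \<le> poly (p * p) t * (t powr (2 * \<mu> + real k) * w t)" if "t \<in> {0..}" for t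
      using weight that by (simp add: weight_on_halfline_def)
    show "\<not> (AE t in lebesgue. t \<in> {0..} \<longrightarrow> poly (p * p) t * (t powr (2 * \<mu> + real k) * w t) = 0)"
    proof
      have "{t. poly p t = 0} \<in> null_sets lebesgue"
        using poly_roots_finite[OF \<open>p \<noteq> 0\<close>]
        by (intro null_sets_completionI finite_imp_null_set_lborel)
      then have "AE t in lebesgue. t \<notin> {t. poly p t = 0}" by (rule AE_not_in)
      moreover assume "AE t in lebesgue. t \<in> {0..} \<longrightarrow> poly (p * p) t * (t powr (2 * \<mu> + real k) * w t) = 0"
      ultimately have "AE t in lebesgue. indicat_real {0..} t *\<^sub>R (t powr (2 * \<mu> + real k) * w t) = 0"
        by eventually_elim (auto simp: indicator_def)
      then have "(LINT t:{0..}|lebesgue. t powr (2 * \<mu> + real k) * w t) = 0"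
        unfolding set_lebesgue_integral_def by (rule integral_eq_zero_AE)
      then show False using weight unfolding weight_on_halfline_def by (metis less_irrefl)
    qed
  qed
qed

end

section \<open>Homogenized polynomials and the orthogonal space\<close>

lemma smult_sum_right: "smult c (\<Sum>j\<in>A. f j) = (\<Sum>j\<in>A. smult c (f j))"
  by (induction A rule: infinite_finite_induct) (simp_all add: smult_add_right)

lemma bpoly_eval_monom: "bpoly_eval (monom r i) x t = poly r t * x ^ i"
  by (simp add: bpoly_eval_def poly_monom poly_const_pow)

lemma bpoly_eval_mult: "bpoly_eval (P * Q) x t = bpoly_eval P x t * bpoly_eval Q x t"
  by (simp add: bpoly_eval_def)

lemma bpoly_scale_monom: "bpoly_scale c (monom r i) = monom (smult c r) i"
  by (simp add: bpoly_scale_def smult_monom)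

lemma coeff_bpoly_scale: "coeff (bpoly_scale c P) i = smult c (coeff P i)"
  by (simp add: bpoly_scale_def)

lemma coeff_homogenize: "coeff (homogenize k p) i = (if i \<le> k then monom (coeff p i) (k - i) else 0)"
proof -
  have "coeff (homogenize k p) i = (\<Sum>j\<le>k. if j = i then monom (coeff p j) (k - j) else 0)"
    unfolding homogenize_def coeff_sum
    by (intro sum.cong) (simp_all add: bmonom_def coeff_bpoly_scale smult_monom)
  then show ?thesis by simp
qed

lemma homogenize_eq_sum: "homogenize k p = (\<Sum>a\<le>k. monom (monom (coeff p a) (k - a)) a)"
  by (simp add: homogenize_def bmonom_def bpoly_scale_monom smult_monom)

lemma homogenize_add: "homogenize k (p + q) = homogenize k p + homogenize k q"
  by (rule poly_eqI) (simp add: coeff_homogenize add_monom)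

lemma homogenize_smult: "homogenize k (smult c p) = bpoly_scale c (homogenize k p)"
  by (rule poly_eqI) (simp add: coeff_homogenize coeff_bpoly_scale smult_monom)

lemma homogenize_sum: "homogenize k (\<Sum>j\<in>A. f j) = (\<Sum>j\<in>A. homogenize k (f j))"
proof (induction A rule: infinite_finite_induct)
  case (insert x A)
  then show ?case by (simp add: homogenize_add)
qed (simp_all add: homogenize_def bpoly_scale_def)

lemma homogenize_monom: "homogenize k (monom 1 k) = monom 1 k"
  by (rule poly_eqI) (simp add: coeff_homogenize one_pCons monom_0)

lemma homogenize_raise:
  assumes "degree p \<le> m"
  shows "smult (monom 1 i) (homogenize m p) = homogenize (m + i) p"
  using assms by (intro poly_eqI) (auto simp: coeff_homogenize mult_monom coeff_eq_0)

lemma subspace_bpolys_deg_less: "bpoly.subspace (bpolys_deg_less n)"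
proof (rule bpoly.subspaceI)
  fix P Q assume PQ: "P \<in> bpolys_deg_less n" "Q \<in> bpolys_deg_less n"
  show "P + Q \<in> bpolys_deg_less n"
    unfolding bpolys_deg_less_def
  proof (intro CollectI allI impI)
    fix i j assume "coeff (coeff (P + Q) i) j \<noteq> 0"
    then have "coeff (coeff P i) j \<noteq> 0 \<or> coeff (coeff Q i) j \<noteq> 0" by auto
    then show "i + j < n" using PQ by (auto simp: bpolys_deg_less_def)
  qed
qed (auto simp: bpolys_deg_less_def coeff_bpoly_scale)

text \<open>Total degrees add: k from the homogenization and the degree of q. The premise is
  conditional so that q = 0 is covered even for k \<ge> n.\<close>

lemma smult_homogenize_deg_less:
  assumes "q \<noteq> 0 \<Longrightarrow> degree q + k < n"
  shows "smult q (homogenize k p) \<in> bpolys_deg_less n"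
  unfolding bpolys_deg_less_def
proof (intro CollectI allI impI)
  fix i j assume nz: "coeff (coeff (smult q (homogenize k p)) i) j \<noteq> 0"
  then have i: "i \<le> k" and "q \<noteq> 0" and j: "j \<le> degree (q * monom (coeff p i) (k - i))"
    by (auto simp: coeff_homogenize split: if_splits intro!: le_degree)
  have "degree (q * monom (coeff p i) (k - i)) \<le> degree q + (k - i)"
    using degree_mult_le[of q "monom (coeff p i) (k - i)"] degree_monom_le[of "coeff p i" "k - i"] by linarith
  then show "i + j < n" using i j assms[OF \<open>q \<noteq> 0\<close>] by linarith
qed

section \<open>Polynomials integrated over the cone\<close>

context cone_weight_setting
begin

definition cone_integral :: "bpoly \<Rightarrow> real" where
  "cone_integral P = (LINT z:cone|lebesgue. bpoly_eval P (fst z) (snd z) * cone_weight \<mu> w (fst z) (snd z))"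

lemma cone_inner_eq: "cone_inner \<mu> w P Q = cone_integral (P * Q)"
  by (simp add: cone_inner_def cone_integral_def bpoly_eval_mult)

text \<open>With x = s t the weight (t^2 - x^2)^(\<mu>-1/2) becomes t^(2\<mu>-1) (1 -
  s^2)^(\<mu>-1/2), so the integrand has the form required by
  \<open>cone_integral_product\<close>.\<close>

lemma
  shows cone_integrable_monom: "set_integrable lebesgue cone (\<lambda>z. bpoly_eval (monom r i) (fst z) (snd z) * cone_weight \<mu> w (fst z) (snd z))" (is ?I)
    and cone_integral_monom: "cone_integral (monom r i) = geg_integral \<mu> (monom 1 i) * half_integral i r" (is ?E)
proof -
  define \<phi> where "\<phi> s = poly (monom 1 i) s * (1 - s\<^sup>2) powr (\<mu> - 1 / 2)" for s :: real
  define v where "v t = poly r t * (t powr (2 * \<mu> + real i) * w t)" for t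
  have eq: "bpoly_eval (monom r i) (fst z) (snd z) * cone_weight \<mu> w (fst z) (snd z) =
      \<phi> (fst z / snd z) * (v (snd z) / snd z)" if "z \<in> cone" for z
  proof -
    obtain x t where z: "z = (x, t)" by (cases z)
    show ?thesis
    proof (cases "t = 0")
      \<comment> \<open>At the apex both sides are 0, by the conventions for \<open>0 powr\<close>
        and for division by 0.\<close>
      case True
      then show ?thesis using that by (simp add: z cone_def cone_weight_def)
    next
      case False
      then have t: "t > 0" and xt: "\<bar>x\<bar> \<le> t" using that by (auto simp: z cone_def)
      have "(x / t)\<^sup>2 \<le> 1" using t xt by (simp add: abs_square_le_1)
      then have nn: "1 - (x / t)\<^sup>2 \<ge> 0" by simp
      have "t\<^sup>2 - x\<^sup>2 = t\<^sup>2 * (1 - (x / t)\<^sup>2)" using t by (simp add: field_simps)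
      then have "(t\<^sup>2 - x\<^sup>2) powr (\<mu> - 1 / 2) = (t\<^sup>2) powr (\<mu> - 1 / 2) * (1 - (x / t)\<^sup>2) powr (\<mu> - 1 / 2)"
        using nn by (simp add: powr_mult)
      also have "(t\<^sup>2) powr (\<mu> - 1 / 2) = t powr (2 * \<mu> - 1)"
        using t powr_powr[of t 2 "\<mu> - 1 / 2"] by (simp add: right_diff_distrib)
      also have "\<dots> = t powr (2 * \<mu>) / t" using t by (simp add: powr_diff)
      finally have 1: "(t\<^sup>2 - x\<^sup>2) powr (\<mu> - 1 / 2) = t powr (2 * \<mu>) / t * (1 - (x / t)\<^sup>2) powr (\<mu> - 1 / 2)" .
      have "t powr (2 * \<mu> + real i) = t powr (2 * \<mu>) * t ^ i" using t by (simp add: powr_add powr_realpow)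
      then show ?thesis
        unfolding z \<phi>_def v_def cone_weight_def bpoly_eval_monom fst_conv snd_conv 1
        using t by (simp add: poly_monom power_divide)
    qed
  qed
  have "\<phi> \<in> borel_measurable borel" unfolding \<phi>_def poly_monom by measurable
  moreover have "set_integrable lebesgue {-1..1} \<phi>"
    unfolding \<phi>_def[abs_def] by (rule set_integrable_poly_geg_weight[OF \<mu>])
  moreover have "set_integrable lebesgue {0..} v"
    unfolding v_def[abs_def] by (rule half_integrable)
  ultimately have *: "set_integrable lebesgue cone (\<lambda>z. \<phi> (fst z / snd z) * (v (snd z) / snd z))"
      "(LINT z:cone|lebesgue. \<phi> (fst z / snd z) * (v (snd z) / snd z)) =
        (LINT s:{-1..1}|lebesgue. \<phi> s) * (LINT t:{0..}|lebesgue. v t)"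
    by (rule cone_integral_product)+
  have ieq: "(\<lambda>z. indicat_real cone z *\<^sub>R (bpoly_eval (monom r i) (fst z) (snd z) * cone_weight \<mu> w (fst z) (snd z)))
      = (\<lambda>z. indicat_real cone z *\<^sub>R (\<phi> (fst z / snd z) * (v (snd z) / snd z)))"
    using eq by (auto simp: indicator_def)
  show ?I using *(1) unfolding set_integrable_def ieq .
  have "cone_integral (monom r i) = (LINT z:cone|lebesgue. \<phi> (fst z / snd z) * (v (snd z) / snd z))"
    unfolding cone_integral_def set_lebesgue_integral_def ieq ..
  then show ?E unfolding *(2) by (simp only: geg_integral_def half_integral_def \<phi>_def[abs_def] v_def[abs_def])
qed

lemma cone_integrable:
  "set_integrable lebesgue cone (\<lambda>z. bpoly_eval P (fst z) (snd z) * cone_weight \<mu> w (fst z) (snd z))"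
proof -
  have eq: "bpoly_eval P x t = (\<Sum>i\<le>degree P. bpoly_eval (monom (coeff P i) i) x t)" for x t
    unfolding bpoly_eval_monom by (simp add: bpoly_eval_def poly_altdef[of P] poly_sum poly_const_pow mult.commute)
  show ?thesis
    unfolding eq sum_distrib_right set_integrable_def scaleR_sum_right
    by (intro Bochner_Integration.integrable_sum cone_integrable_monom[unfolded set_integrable_def])
qed

lemma cone_integral_add: "cone_integral (P + Q) = cone_integral P + cone_integral Q"
  unfolding cone_integral_def using cone_integrable[of P] cone_integrable[of Q]
  by (simp add: bpoly_eval_def distrib_right)

lemma cone_integral_scale: "cone_integral (bpoly_scale c P) = c * cone_integral P"
  unfolding cone_integral_def by (simp add: bpoly_eval_def bpoly_scale_def mult.assoc)

lemma cone_integral_0: "cone_integral 0 = 0"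
  unfolding cone_integral_def by (simp add: bpoly_eval_def)

lemma cone_integral_sum: "cone_integral (\<Sum>j\<in>A. f j) = (\<Sum>j\<in>A. cone_integral (f j))"
  by (induction A rule: infinite_finite_induct) (simp_all add: cone_integral_0 cone_integral_add)

sublocale geg: gegenbauer_functional \<mu> "geg_integral \<mu>"
  by (rule gegenbauer_functional_geg_integral[OF \<mu>])

sublocale half: positive_functional "half_integral k" for k
  by (rule positive_half_integral)

text \<open>The term t^(k-a) x^a has t^(k-a) from the homogenization and gains t^a from x = s t, so
  the half-line integral is the same for all a and factors out.\<close>

lemma cone_integral_homogenize_monom:
  assumes "degree p \<le> k"
  shows "cone_integral (smult q (homogenize k p) * monom r i) =
    geg_integral \<mu> (p * monom 1 i) * half_integral (k + i) (q * r)"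
proof -
  have geg_sum: "geg_integral \<mu> (\<Sum>a\<in>A. f a) = (\<Sum>a\<in>A. geg_integral \<mu> (f a))" for A and f :: "nat \<Rightarrow> real poly"
    by (induction A rule: infinite_finite_induct) (simp_all add: geg.zero geg.add)
  have "smult q (homogenize k p) * monom r i
      = (\<Sum>a\<le>k. bpoly_scale (coeff p a) (monom (q * r * monom 1 (k - a)) (a + i)))"
  proof -
    have "smult q (monom (monom (coeff p a) (k - a)) a) * monom r i
        = bpoly_scale (coeff p a) (monom (q * r * monom 1 (k - a)) (a + i))" for a
    proof -
      have "monom (coeff p a) (k - a) = smult (coeff p a) (monom 1 (k - a))" by (simp add: smult_monom)
      moreover have "smult q (monom (smult c m) a) * monom r i = bpoly_scale c (monom (q * r * m) (a + i))" for c m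
        by (simp add: bpoly_scale_monom smult_monom mult_monom mult_ac add.commute)
      ultimately show ?thesis by (simp only:)
    qed
    then show ?thesis
      unfolding homogenize_eq_sum smult_sum_right sum_distrib_right by simp
  qed
  then have "cone_integral (smult q (homogenize k p) * monom r i)
      = (\<Sum>a\<le>k. coeff p a * (geg_integral \<mu> (monom 1 (a + i)) * half_integral (a + i) (q * r * monom 1 (k - a))))"
    by (simp add: cone_integral_sum cone_integral_scale cone_integral_monom)
  also have "\<dots> = (\<Sum>a\<le>k. geg_integral \<mu> (smult (coeff p a) (monom 1 (a + i)))) * half_integral (k + i) (q * r)"
    unfolding sum_distrib_right
    by (intro sum.cong) (simp_all add: half_integral_mult_monom geg.smult add.commute add.left_commute)
  also have "(\<Sum>a\<le>k. geg_integral \<mu> (smult (coeff p a) (monom 1 (a + i)))) = geg_integral \<mu> (p * monom 1 i)"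
  proof -
    have "p = (\<Sum>a\<le>k. monom (coeff p a) a)" using poly_as_sum_of_monoms'[OF assms] by simp
    then have "p * monom 1 i = (\<Sum>a\<le>k. monom (coeff p a) a * monom 1 i)"
      unfolding sum_distrib_right[symmetric] by simp
    then show ?thesis by (simp add: geg_sum mult_monom smult_monom)
  qed
  finally show ?thesis .
qed

lemma cone_integral_mult:
  "cone_integral (P * Q) = (\<Sum>i\<le>degree Q. cone_integral (P * monom (coeff Q i) i))"
  by (subst (1) poly_as_sum_of_monoms[of Q, symmetric]) (simp only: sum_distrib_left cone_integral_sum)

lemma is_monic_orth_poly_monic_orth_poly:
  "is_monic_orth_poly (2 * real k + 2 * \<mu>) w m (monic_orth_poly (2 * real k + 2 * \<mu>) w m)"
proof -
  have "is_monic_orth_poly (2 * real k + 2 * \<mu>) w m p \<longleftrightarrow>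
      degree p = m \<and> lead_coeff p = 1 \<and> (\<forall>r. degree r < m \<longrightarrow> half_integral (2 * k) (p * r) = 0)" for p
    unfolding is_monic_orth_poly_def half_integral_def by (simp add: add.commute)
  then have "\<exists>!p. is_monic_orth_poly (2 * real k + 2 * \<mu>) w m p"
    using half.ex1_monic_orthogonal[of m "2 * k"] by simp
  then show ?thesis unfolding monic_orth_poly_def by (rule theI')
qed

lemma
  shows degree_monic_orth_poly: "degree (monic_orth_poly (2 * real k + 2 * \<mu>) w m) = m"
    and lead_coeff_monic_orth_poly: "coeff (monic_orth_poly (2 * real k + 2 * \<mu>) w m) m = 1"
    and monic_orth_poly_orthogonal:
      "degree r < m \<Longrightarrow> half_integral (2 * k) (monic_orth_poly (2 * real k + 2 * \<mu>) w m * r) = 0"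
  using is_monic_orth_poly_monic_orth_poly[of k m]
  unfolding is_monic_orth_poly_def half_integral_def by (auto simp: add.commute)

lemma S_poly_orthogonal:
  assumes "k \<le> n" "g \<in> bpolys_deg_less n"
  shows "cone_integral (S_poly \<mu> w k n * g) = 0"
  unfolding cone_integral_mult[of _ g]
proof (rule sum.neutral, rule ballI)
  fix i
  define q where "q = monic_orth_poly (2 * real k + 2 * \<mu>) w (n - k)"
  have eq: "cone_integral (S_poly \<mu> w k n * monom (coeff g i) i) =
      geg_integral \<mu> (geg_or_cheb \<mu> k * monom 1 i) * half_integral (k + i) (q * coeff g i)"
    unfolding S_poly_def q_def by (rule cone_integral_homogenize_monom[OF degree_geg_or_cheb])
  show "cone_integral (S_poly \<mu> w k n * monom (coeff g i) i) = 0"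
  proof (cases "i < k")
    case True
    then show ?thesis
      using geg.monic_geg_orthogonal[OF True]
      by (simp add: eq geg_or_cheb_eq_monic_geg[OF \<mu>] geg.smult)
  next
    case False
    show ?thesis
    proof (cases "coeff g i = 0")
      case True
      then show ?thesis by (simp add: cone_integral_0)
    next
      case nz: False
      then have "coeff (coeff g i) (degree (coeff g i)) \<noteq> 0" by simp
      then have "i + degree (coeff g i) < n" using assms(2) unfolding bpolys_deg_less_def by blast
      then have deg: "degree (coeff g i * monom 1 (i - k)) < n - k"
        using nz False by (simp add: degree_mult_eq degree_monom_eq)
      \<comment> \<open>The surplus power t^(i-k) moves from the weight into the test polynomial,
        leaving the weight of q.\<close>
      have "half_integral (k + i) (q * coeff g i) = half_integral (2 * k) (q * (coeff g i * monom 1 (i - k)))"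
        using False half_integral_mult_monom[of "2 * k" "q * coeff g i" "i - k"] by (simp add: mult.assoc)
      also have "\<dots> = 0" unfolding q_def by (rule monic_orth_poly_orthogonal[OF deg])
      finally show ?thesis by (simp add: eq)
    qed
  qed
qed

text \<open>Only the top power of \<open>x\<close> in \<open>Q\<close> survives integration against the test polynomial.\<close>

lemma ex_cone_integral_nonzero:
  assumes "Q \<in> bpolys_deg_less n" "Q \<noteq> 0"
  shows "\<exists>g \<in> bpolys_deg_less n. cone_integral (Q * g) \<noteq> 0"
proof
  define d r where "d = degree Q" and "r = coeff Q d"
  \<comment> \<open>The Gegenbauer factor kills the powers of x below d; the factor r makes the
    surviving half-line integral that of a square.\<close>
  let ?g = "smult r (homogenize d (monic_geg \<mu> d))"
  have r: "r \<noteq> 0" using assms(2) by (simp add: d_def r_def)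
  then have "coeff (coeff Q d) (degree r) \<noteq> 0" by (simp add: r_def)
  then have "d + degree r < n" using assms(1) unfolding bpolys_deg_less_def by blast
  then show "?g \<in> bpolys_deg_less n" by (intro smult_homogenize_deg_less) simp
  have "cone_integral (Q * ?g) = (\<Sum>i\<le>d. cone_integral (?g * monom (coeff Q i) i))"
    unfolding mult.commute[of Q] d_def by (rule cone_integral_mult)
  also have "\<dots> = (\<Sum>i\<le>d. geg_integral \<mu> (monic_geg \<mu> d * monom 1 i) * half_integral (d + i) (r * coeff Q i))"
    by (intro sum.cong cone_integral_homogenize_monom degree_monic_geg refl)
  also have "\<dots> = (\<Sum>i\<le>d. if i = d then geg_integral \<mu> (monic_geg \<mu> d * monom 1 d) * half_integral (d + d) (r * r) else 0)"
    by (intro sum.cong) (auto simp: geg.monic_geg_orthogonal r_def)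
  also have "\<dots> = geg_integral \<mu> (monic_geg \<mu> d * monom 1 d) * half_integral (d + d) (r * r)" by simp
  also have "\<dots> > 0" using geg.monic_geg_top_moment_pos half.pos[OF r] by simp
  finally show "cone_integral (Q * ?g) \<noteq> 0" by simp
qed

section \<open>The orthogonal space and its monomial basis\<close>

lemma orth_space_iff:
  "P \<in> orth_space \<mu> w n \<longleftrightarrow> P \<in> bpolys_deg_le n \<and> (\<forall>g \<in> bpolys_deg_less n. cone_integral (P * g) = 0)"
  by (simp add: orth_space_def cone_inner_eq)

lemma subspace_orth_space: "bpoly.subspace (orth_space \<mu> w n)"
proof (rule bpoly.subspaceI)
  have le: "bpolys_deg_le n = bpolys_deg_less (Suc n)"
    by (simp add: bpolys_deg_le_def bpolys_deg_less_def less_Suc_eq_le)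
  note sub = subspace_bpolys_deg_less[of "Suc n", folded le]
  show "0 \<in> orth_space \<mu> w n"
    using bpoly.subspace_0[OF sub] by (simp add: orth_space_iff cone_integral_0)
  show "P + Q \<in> orth_space \<mu> w n" if "P \<in> orth_space \<mu> w n" "Q \<in> orth_space \<mu> w n" for P Q
    using that bpoly.subspace_add[OF sub] by (simp add: orth_space_iff cone_integral_add distrib_right)
  show "bpoly_scale c P \<in> orth_space \<mu> w n" if "P \<in> orth_space \<mu> w n" for c P
  proof -
    have "bpoly_scale c P * g = bpoly_scale c (P * g)" for g by (simp add: bpoly_scale_def)
    then show ?thesis
      using that bpoly.subspace_scale[OF sub] by (simp add: orth_space_iff cone_integral_scale)
  qed
qed

text \<open>P is orthogonal to the whole space in which it lies, and the inner product is
  nondegenerate there.\<close>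

lemma orth_space_deg_less_eq_0:
  assumes "P \<in> orth_space \<mu> w n" "P \<in> bpolys_deg_less n"
  shows "P = 0"
  using assms ex_cone_integral_nonzero orth_space_iff by blast

text \<open>Each q is replaced by its leading power of t. These parts add up to t^(n-k) x^k, and the
  corrections have lower degree since q is monic.\<close>

lemma V_poly_is_monomial:
  assumes "k \<le> n"
  shows "is_monomial_poly n k (V_poly \<mu> w k n)"
proof -
  define q where "q j = monic_orth_poly (2 * real (k - 2 * j) + 2 * \<mu>) w (n - (k - 2 * j))" for j
  define h where "h j = homogenize (k - 2 * j) (geg_or_cheb \<mu> (k - 2 * j))" for j
  define e where "e j = n - (k - 2 * j)" for j
  let ?c = "monom_coeff \<mu> k"
  have top: "(\<Sum>j\<le>k div 2. bpoly_scale (?c j) (smult (monom 1 (e j)) (h j))) = bmonom k (n - k)"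
  proof -
    have "bpoly_scale (?c j) (smult (monom 1 (e j)) (h j)) =
        smult (monom 1 (n - k)) (homogenize k (smult (geg_expand \<mu> k j) (monic_geg \<mu> (k - 2 * j))))"
      if "j \<in> {..k div 2}" for j
    proof -
      have j: "2 * j \<le> k" using that by auto
      \<comment> \<open>The factor t^(2j) raises the homogenization from degree k - 2j to k, so that
        t^(n-k) is common to all terms.\<close>
      have "monom (1::real) (e j) = monom 1 (n - k) * monom 1 (2 * j)"
        using j assms by (simp add: mult_monom e_def)
      then have "smult (monom 1 (e j)) (h j) = smult (monom 1 (n - k)) (homogenize k (geg_or_cheb \<mu> (k - 2 * j)))"
        using homogenize_raise[OF degree_geg_or_cheb[of \<mu> "k - 2 * j"], of "2 * j"] j
        by (simp add: h_def flip: smult_smult)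
      moreover have "smult (?c j) (geg_or_cheb \<mu> (k - 2 * j)) = smult (geg_expand \<mu> k j) (monic_geg \<mu> (k - 2 * j))"
        by (simp add: geg_or_cheb_eq_monic_geg[OF \<mu>] geg_expand_eq[OF \<mu> j])
      moreover have "bpoly_scale c (smult m P) = smult m (bpoly_scale c P)" for c m P
        by (simp add: bpoly_scale_def mult.commute)
      ultimately show ?thesis by (simp only: homogenize_smult[symmetric])
    qed
    then have "(\<Sum>j\<le>k div 2. bpoly_scale (?c j) (smult (monom 1 (e j)) (h j))) =
        smult (monom 1 (n - k)) (homogenize k (monom 1 k))"
      unfolding monom_eq_sum_monic_geg[OF \<mu>, of k] homogenize_sum smult_sum_right by (rule sum.cong[OF refl])
    then show ?thesis unfolding homogenize_monom bmonom_def by (simp add: smult_monom)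
  qed
  have low: "smult (q j - monom 1 (e j)) (h j) \<in> bpolys_deg_less n" if "2 * j \<le> k" for j
    unfolding h_def
  proof (rule smult_homogenize_deg_less)
    assume nz: "q j - monom 1 (e j) \<noteq> 0"
    have "degree (q j - monom 1 (e j)) \<le> e j"
      using degree_monic_orth_poly[of "k - 2 * j" "e j"]
      by (intro degree_diff_le) (simp_all add: q_def e_def degree_monom_le)
    moreover have "coeff (q j - monom 1 (e j)) (e j) = 0"
      using lead_coeff_monic_orth_poly[of "k - 2 * j" "e j"] by (simp add: q_def e_def)
    ultimately have "degree (q j - monom 1 (e j)) < e j"
      using nz by (metis leading_coeff_0_iff le_neq_implies_less)
    then show "degree (q j - monom 1 (e j)) + (k - 2 * j) < n"
      using assms by (simp add: e_def)
  qed
  have "V_poly \<mu> w k n - bmonom k (n - k) =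
      (\<Sum>j\<le>k div 2. bpoly_scale (?c j) (smult (q j - monom 1 (e j)) (h j)))"
    unfolding top[symmetric] V_poly_def S_poly_def atLeast0AtMost sum_subtractf[symmetric]
    by (intro sum.cong) (simp_all add: q_def h_def e_def bpoly_scale_def smult_diff_left smult_diff_right algebra_simps)
  also have "\<dots> \<in> bpolys_deg_less n"
    by (intro bpoly.subspace_sum bpoly.subspace_scale subspace_bpolys_deg_less low) auto
  finally show ?thesis unfolding is_monomial_poly_def .
qed

lemma is_monomial_poly_deg_le:
  assumes "k \<le> n" "is_monomial_poly n k P"
  shows "P \<in> bpolys_deg_le n"
  unfolding bpolys_deg_le_def
proof (intro CollectI allI impI)
  fix i j assume nz: "coeff (coeff P i) j \<noteq> 0"
  show "i + j \<le> n"
  proof (cases "i = k \<and> j = n - k")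
    case False
    then have "coeff (coeff (bmonom k (n - k)) i) j = 0" by (auto simp: bmonom_def)
    then have "coeff (coeff (P - bmonom k (n - k)) i) j \<noteq> 0" using nz by simp
    then show ?thesis using assms(2) unfolding is_monomial_poly_def bpolys_deg_less_def by fastforce
  qed (use assms(1) in simp)
qed

lemma V_poly_in_orth_space:
  assumes "k \<le> n"
  shows "V_poly \<mu> w k n \<in> orth_space \<mu> w n"
  unfolding orth_space_iff
proof (intro conjI ballI)
  show "V_poly \<mu> w k n \<in> bpolys_deg_le n"
    by (rule is_monomial_poly_deg_le[OF assms V_poly_is_monomial[OF assms]])
  fix g assume g: "g \<in> bpolys_deg_less n"
  have "V_poly \<mu> w k n * g = (\<Sum>j = 0..k div 2. bpoly_scale (monom_coeff \<mu> k j) (S_poly \<mu> w (k - 2 * j) n * g))"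
    unfolding V_poly_def sum_distrib_right by (simp add: bpoly_scale_def)
  then show "cone_integral (V_poly \<mu> w k n * g) = 0"
    using assms by (simp add: cone_integral_sum cone_integral_scale S_poly_orthogonal[OF _ g])
qed

lemma is_monomial_poly_coeff:
  assumes "is_monomial_poly n k P" "i \<le> n" "k \<le> n"
  shows "coeff (coeff P i) (n - i) = (if i = k then 1 else 0)"
proof -
  have "coeff (coeff (P - bmonom k (n - k)) i) (n - i) = 0"
    using assms unfolding is_monomial_poly_def bpolys_deg_less_def by fastforce
  then show ?thesis by (auto simp: bmonom_def)
qed

text \<open>The coefficients of total degree n serve as coordinates, which gives injectivity and
  independence. For the span, an element and the combination with the same coordinates differ by an
  orthogonal polynomial of lower degree, which is 0.\<close>

lemma is_basis_family_monomial:
  assumes mono: "\<And>k. k \<le> n \<Longrightarrow> is_monomial_poly n k (V k)"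
    and orth: "\<And>k. k \<le> n \<Longrightarrow> V k \<in> orth_space \<mu> w n"
  shows "is_basis_family {..n} V (orth_space \<mu> w n)"
  unfolding is_basis_family_def
proof (intro conjI)
  have c: "coeff (coeff (V k) i) (n - i) = (if i = k then 1 else 0)" if "i \<le> n" "k \<le> n" for i k
    using is_monomial_poly_coeff[OF mono[OF that(2)] that] .
  show inj: "inj_on V {..n}"
  proof (rule inj_onI)
    fix k l assume "k \<in> {..n}" "l \<in> {..n}" "V k = V l"
    then show "k = l" using c[of k k] c[of k l] by (auto split: if_splits)
  qed
  have sum_coeff: "coeff (coeff (\<Sum>k\<le>n. bpoly_scale (f k) (V k)) i) (n - i) = f i" if "i \<le> n" for f i
  proof -
    have "coeff (coeff (\<Sum>k\<le>n. bpoly_scale (f k) (V k)) i) (n - i) = (\<Sum>k\<le>n. if k = i then f k else 0)"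
      unfolding coeff_sum by (intro sum.cong) (auto simp: coeff_bpoly_scale c that)
    then show ?thesis using that by simp
  qed
  show "bpoly.independent (V ` {..n})"
  proof (rule bpoly.independent_if_scalars_zero)
    fix f x assume s: "(\<Sum>x\<in>V ` {..n}. bpoly_scale (f x) x) = 0" and "x \<in> V ` {..n}"
    then obtain i where i: "i \<le> n" "x = V i" by auto
    have "(\<Sum>k\<le>n. bpoly_scale (f (V k)) (V k)) = 0"
      using s by (simp add: sum.reindex[OF inj])
    then show "f x = 0" using sum_coeff[OF i(1), of "\<lambda>k. f (V k)"] i(2) by simp
  qed simp
  show "bpoly.span (V ` {..n}) = orth_space \<mu> w n"
  proof
    show "bpoly.span (V ` {..n}) \<subseteq> orth_space \<mu> w n"
      by (rule bpoly.span_minimal[OF _ subspace_orth_space]) (use orth in auto)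
    show "orth_space \<mu> w n \<subseteq> bpoly.span (V ` {..n})"
    proof
      fix P assume P: "P \<in> orth_space \<mu> w n"
      define T where "T = (\<Sum>k\<le>n. bpoly_scale (coeff (coeff P k) (n - k)) (V k))"
      have T: "T \<in> orth_space \<mu> w n"
        unfolding T_def by (intro bpoly.subspace_sum bpoly.subspace_scale subspace_orth_space orth) simp
      have "P - T \<in> bpolys_deg_less n"
        unfolding bpolys_deg_less_def
      proof (intro CollectI allI impI)
        fix i j assume nz: "coeff (coeff (P - T) i) j \<noteq> 0"
        have PT: "P - T \<in> bpolys_deg_le n"
          using bpoly.subspace_diff[OF subspace_orth_space P T] by (simp add: orth_space_iff)
        then have le: "i + j \<le> n" using nz unfolding bpolys_deg_le_def by blast
        have "i + j \<noteq> n"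
        proof
          assume "i + j = n"
          then have "j = n - i" "i \<le> n" by auto
          then show False using nz sum_coeff[of i "\<lambda>k. coeff (coeff P k) (n - k)"] by (simp add: T_def)
        qed
        then show "i + j < n" using le by simp
      qed
      then have "P - T = 0"
        using orth_space_deg_less_eq_0 bpoly.subspace_diff[OF subspace_orth_space P T] by blast
      then have "P = T" by simp
      also have "T \<in> bpoly.span (V ` {..n})"
        unfolding T_def by (intro bpoly.span_sum bpoly.span_scale bpoly.span_base) simp
      finally show "P \<in> bpoly.span (V ` {..n})" .
    qed
  qed
qed

text \<open>The leading monomials cancel, so the difference has degree below n and is still in the
  orthogonal space.\<close>

lemma monomial_poly_unique:
  assumes "is_monomial_poly n k P" "is_monomial_poly n k Q" "P \<in> orth_space \<mu> w n" "Q \<in> orth_space \<mu> w n"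
  shows "P = Q"
proof -
  have "(P - bmonom k (n - k)) - (Q - bmonom k (n - k)) \<in> bpolys_deg_less n"
    using assms(1,2) unfolding is_monomial_poly_def by (rule bpoly.subspace_diff[OF subspace_bpolys_deg_less])
  then have "P - Q \<in> bpolys_deg_less n" by simp
  moreover have "P - Q \<in> orth_space \<mu> w n"
    using assms(3,4) by (rule bpoly.subspace_diff[OF subspace_orth_space])
  ultimately have "P - Q = 0" by (intro orth_space_deg_less_eq_0)
  then show ?thesis by simp
qed

end

theorem theorem3p1:
  fixes \<mu> :: real and w :: "real \<Rightarrow> real" and n :: nat
  assumes "\<mu> > - 1 / 2"
    and "weight_on_halfline \<mu> w"
  shows "(\<forall>k\<le>n. is_monomial_poly n k (V_poly \<mu> w k n)) \<and>
         is_monomial_basis \<mu> w n (\<lambda>k. V_poly \<mu> w k n) \<and>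
         (\<forall>P. is_monomial_basis \<mu> w n P \<longrightarrow> (\<forall>k\<le>n. P k = V_poly \<mu> w k n))"
proof -
  interpret cone_weight_setting \<mu> w by standard (use assms in auto)
  have basis: "is_monomial_basis \<mu> w n (\<lambda>k. V_poly \<mu> w k n)"
    unfolding is_monomial_basis_def
    by (intro conjI allI impI is_basis_family_monomial V_poly_is_monomial V_poly_in_orth_space)
  have "P k = V_poly \<mu> w k n" if P: "is_monomial_basis \<mu> w n P" and k: "k \<le> n" for P k
  proof (rule monomial_poly_unique)
    show "is_monomial_poly n k (P k)" using P k by (simp add: is_monomial_basis_def)
    have "P k \<in> bpoly.span (P ` {..n})" using k by (intro bpoly.span_base) simp
    then show "P k \<in> orth_space \<mu> w n" using P by (simp add: is_monomial_basis_def is_basis_family_def)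
  qed (use k V_poly_is_monomial V_poly_in_orth_space in auto)
  then show ?thesis using basis V_poly_is_monomial by blast
qed

end
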